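(* Let $F$ be a formally real field (so in particular of characteristic $0$), and let $\mathcal{G}_F$ be its W-group with Frattini subgroup $\Phi(\mathcal{G}_F)$. Then $\Phi(\mathcal{G}_F)$ is a central elementary abelian $2$-subgroup of $\mathcal{G}_F$, and it has index two in every maximal elementary abelian subgroup of $\mathcal{G}_F$.
   Context: For a field $F$ of characteristic $\neq 2$, let $F_q$ be its quadratic closure and $G_F=\mathrm{Gal}(F_q/F)$. The W-group of $F$ is $\mathcal{G}_F=G_F/G_F^4[G_F^2,G_F]$, where $G_F^4[G_F^2,G_F]$ is the closed subgroup generated by all fourth powers and all commutators $[x^2,y]$, $x,y\in G_F$. $\Phi(\mathcal{G}_F)$ denotes the (closed) Frattini subgroup of the pro-$2$-group $\mathcal{G}_F$. A field is formally real if $-1$ is not a sum of squares in it. *)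

theory Defs
  imports "HOL-Algebra.Algebra"
begin

definition subfield_of :: "'a::field set \<Rightarrow> bool" where
  "subfield_of F \<longleftrightarrow> 0 \<in> F \<and> 1 \<in> F \<and>
     (\<forall>x\<in>F. \<forall>y\<in>F. x + y \<in> F \<and> x - y \<in> F \<and> x * y \<in> F) \<and>
     (\<forall>x\<in>F. inverse x \<in> F)"

definition formally_real :: "'a::field set \<Rightarrow> bool" where
  "formally_real F \<longleftrightarrow>
     \<not> (\<exists>(xs::'a list). set xs \<subseteq> F \<and> sum_list (map (\<lambda>x. x * x) xs) = - 1)"

text \<open>Elements obtainable from F by field operations and square roots,
  i.e. the union of all finite towers of quadratic extensions of F.\<close>
inductive_set quad_constructible :: "'a::field set \<Rightarrow> 'a set" for F where
  base: "x \<in> F \<Longrightarrow> x \<in> quad_constructible F"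
| add: "x \<in> quad_constructible F \<Longrightarrow> y \<in> quad_constructible F \<Longrightarrow> x + y \<in> quad_constructible F"
| neg: "x \<in> quad_constructible F \<Longrightarrow> - x \<in> quad_constructible F"
| mult: "x \<in> quad_constructible F \<Longrightarrow> y \<in> quad_constructible F \<Longrightarrow> x * y \<in> quad_constructible F"
| inv: "x \<in> quad_constructible F \<Longrightarrow> inverse x \<in> quad_constructible F"
| sqrt: "y * y \<in> quad_constructible F \<Longrightarrow> y \<in> quad_constructible F"

definition is_quadratic_closure :: "'a::field set \<Rightarrow> bool" where
  "is_quadratic_closure F \<longleftrightarrow>
     (\<forall>x::'a. \<exists>y. y * y = x) \<and> quad_constructible F = UNIV"

definition field_auto :: "('a::field \<Rightarrow> 'a) \<Rightarrow> bool" where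
  "field_auto \<sigma> \<longleftrightarrow> bij \<sigma> \<and> (\<forall>x y. \<sigma> (x + y) = \<sigma> x + \<sigma> y) \<and>
     (\<forall>x y. \<sigma> (x * y) = \<sigma> x * \<sigma> y) \<and> \<sigma> 1 = 1"

definition Gal :: "'a::field set \<Rightarrow> ('a \<Rightarrow> 'a) monoid" where
  "Gal F = \<lparr>carrier = {\<sigma>. field_auto \<sigma> \<and> (\<forall>x\<in>F. \<sigma> x = x)},
            monoid.mult = (\<circ>), one = id\<rparr>"

text \<open>Krull topology = topology of pointwise convergence (L discrete).\<close>
definition krull_closure :: "'a::field set \<Rightarrow> ('a \<Rightarrow> 'a) set \<Rightarrow> ('a \<Rightarrow> 'a) set" where
  "krull_closure F S = {\<sigma>. \<sigma> \<in> carrier (Gal F) \<and>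
      (\<forall>Fin. finite Fin \<longrightarrow> (\<exists>s\<in>S. \<forall>x\<in>Fin. s x = \<sigma> x))}"

definition krull_open :: "'a::field set \<Rightarrow> ('a \<Rightarrow> 'a) set \<Rightarrow> bool" where
  "krull_open F H \<longleftrightarrow> (\<forall>\<tau>\<in>H. \<exists>Fin. finite Fin \<and>
      {\<sigma>. \<sigma> \<in> carrier (Gal F) \<and> (\<forall>x\<in>Fin. \<sigma> x = \<tau> x)} \<subseteq> H)"

definition commutator :: "('a, 'b) monoid_scheme \<Rightarrow> 'a \<Rightarrow> 'a \<Rightarrow> 'a" where
  "commutator G x y = inv\<^bsub>G\<^esub> x \<otimes>\<^bsub>G\<^esub> inv\<^bsub>G\<^esub> y \<otimes>\<^bsub>G\<^esub> x \<otimes>\<^bsub>G\<^esub> y"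

definition W_kernel :: "'a::field set \<Rightarrow> ('a \<Rightarrow> 'a) set" where
  "W_kernel F = krull_closure F (generate (Gal F)
     ({x [^]\<^bsub>Gal F\<^esub> (4::nat) | x. x \<in> carrier (Gal F)} \<union>
      {commutator (Gal F) (x [^]\<^bsub>Gal F\<^esub> (2::nat)) y | x y.
          x \<in> carrier (Gal F) \<and> y \<in> carrier (Gal F)}))"

definition W_group :: "'a::field set \<Rightarrow> ('a \<Rightarrow> 'a) set monoid" where
  "W_group F = Gal F Mod W_kernel F"

text \<open>Open subsets of the quotient (quotient topology): union of the cosets is open.\<close>
definition W_open :: "'a::field set \<Rightarrow> ('a \<Rightarrow> 'a) set set \<Rightarrow> bool" where
  "W_open F U \<longleftrightarrow> krull_open F (\<Union>U)"

definition W_frattini :: "'a::field set \<Rightarrow> ('a \<Rightarrow> 'a) set set" where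
  "W_frattini F = carrier (W_group F) \<inter>
     \<Inter>{M. subgroup M (W_group F) \<and> W_open F M \<and> M \<noteq> carrier (W_group F) \<and>
          (\<forall>M'. subgroup M' (W_group F) \<and> M \<subseteq> M' \<longrightarrow>
                 M' = M \<or> M' = carrier (W_group F))}"

definition elem_abelian_2_subgroup :: "'a set \<Rightarrow> ('a, 'b) monoid_scheme \<Rightarrow> bool" where
  "elem_abelian_2_subgroup A G \<longleftrightarrow> subgroup A G \<and>
     (\<forall>a\<in>A. a \<otimes>\<^bsub>G\<^esub> a = \<one>\<^bsub>G\<^esub>) \<and>
     (\<forall>a\<in>A. \<forall>b\<in>A. a \<otimes>\<^bsub>G\<^esub> b = b \<otimes>\<^bsub>G\<^esub> a)"

definition maximal_elem_abelian_subgroup :: "'a set \<Rightarrow> ('a, 'b) monoid_scheme \<Rightarrow> bool" where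
  "maximal_elem_abelian_subgroup A G \<longleftrightarrow> elem_abelian_2_subgroup A G \<and>
     (\<forall>B. elem_abelian_2_subgroup B G \<and> A \<subseteq> B \<longrightarrow> B = A)"

end

(* Write N for the kernel of Gal F -> W(F) and i for a square root of -1.  The proof works with the field
   fixed by N, which consists of the x with g^4 x = x and g^2 h x = h g^2 x for all g, h in Gal F, and
   which contains the square roots and the fourth roots of the elements of F.  The Frattini subgroup of
   W(F) is the image of the automorphisms fixing all square roots of elements of F: these are limits of
   products of squares, so they act on the fixed field of N by central involutions.  If s is an involution
   modulo N that moves the square root d^2 of some element of F, then s d = i d or s d = - i d, and
   s (s d) = d forces s i = - i.  So the product of two such commuting involutions fixes i and lies in the
   Frattini subgroup; this bounds the index by two.  Formal reality of F provides a real closed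
   subfield R with R(i) everything, whose conjugation is an involution outside the Frattini subgroup. *)

theory Submission
  imports Defs "HOL-Computational_Algebra.Polynomial"
begin

section \<open>Extending automorphisms through square roots\<close>

text \<open>The group is infinite, and both the kernel and the Frattini subgroup are defined
  topologically. What makes them computable is one half of the Galois correspondence,
  \<open>krull_closure_generate\<close>: an automorphism lies in the closed subgroup generated by S
  as soon as it fixes everything that S fixes. Applied to the defining generators, this describes
  the kernel; applied to the squares, it reduces the density claim to Kummer theory of exponent two,
  namely that an element fixed by all squares is a sum of square roots of elements of F. Fourth
  roots are the right test elements because the group of F(d, i) with d^4 in F embeds into the
  dihedral group of order eight: rich enough to tell reflections from rotations of order four, small
  enough that its squares are central. The index is two and never one because the Frattini subgroup
  is central: adjoining the conjugation to it gives a larger elementary abelian group, so it is not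
  itself maximal.\<close>

lemma subfield_ofI_ring:
  fixes K :: "'a::field set"
  assumes "0 \<in> K" "1 \<in> K" "\<And>x y. x \<in> K \<Longrightarrow> y \<in> K \<Longrightarrow> x + y \<in> K"
    "\<And>x. x \<in> K \<Longrightarrow> - x \<in> K" "\<And>x y. x \<in> K \<Longrightarrow> y \<in> K \<Longrightarrow> x * y \<in> K"
    "\<And>x. x \<in> K \<Longrightarrow> inverse x \<in> K"
  shows "subfield_of K"
  unfolding subfield_of_def
  using assms by (metis add_uminus_conv_diff)

lemma subfield_of_closed:
  assumes "subfield_of K"
  shows "0 \<in> K" "1 \<in> K" "x \<in> K \<Longrightarrow> y \<in> K \<Longrightarrow> x + y \<in> K"
    "x \<in> K \<Longrightarrow> y \<in> K \<Longrightarrow> x - y \<in> K" "x \<in> K \<Longrightarrow> - x \<in> K" "x \<in> K \<Longrightarrow> y \<in> K \<Longrightarrow> x * y \<in> K"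
    "x \<in> K \<Longrightarrow> inverse x \<in> K" "x \<in> K \<Longrightarrow> y \<in> K \<Longrightarrow> x / y \<in> K"
  using assms unfolding subfield_of_def divide_inverse
  by (blast, blast, blast, blast, metis diff_0, blast, blast, blast)

text \<open>Zorn's lemma restricted to the sets above \<open>S\<close>. The set \<open>S\<close>
  takes care of the empty chain, so only nonempty chains need an upper bound.\<close>

lemma maximal_superset:
  assumes "P S" "\<And>\<C>. \<C> \<noteq> {} \<Longrightarrow> subset.chain {T. P T} \<C> \<Longrightarrow> (\<And>T. T \<in> \<C> \<Longrightarrow> P T) \<Longrightarrow> P (\<Union>\<C>)"
  obtains M where "P M" "S \<subseteq> M" "\<And>T. P T \<Longrightarrow> M \<subseteq> T \<Longrightarrow> T = M"
proof -
  let ?A = "{T. P T \<and> S \<subseteq> T}"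
  have "\<exists>M\<in>?A. \<forall>T\<in>?A. M \<subseteq> T \<longrightarrow> T = M"
  proof (rule subset_Zorn_nonempty)
    show "?A \<noteq> {}" using assms(1) by blast
    fix \<C> assume C: "\<C> \<noteq> {}" "subset.chain ?A \<C>"
    then have "\<C> \<subseteq> ?A" "subset.chain {T. P T} \<C>" unfolding subset.chain_def by auto
    moreover from this have "P (\<Union>\<C>)" using assms(2)[OF C(1)] by blast
    ultimately show "\<Union>\<C> \<in> ?A" using C(1) by blast
  qed
  then obtain M where "M \<in> ?A" "\<forall>T\<in>?A. M \<subseteq> T \<longrightarrow> T = M" by (rule bexE)
  then show ?thesis by (intro that[of M]) auto
qed

lemma chain_directed:
  assumes "subset.chain \<A> \<C>" "x \<in> \<Union>\<C>" "y \<in> \<Union>\<C>"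
  obtains K where "K \<in> \<C>" "x \<in> K" "y \<in> K"
proof -
  obtain K L where KL: "K \<in> \<C>" "x \<in> K" "L \<in> \<C>" "y \<in> L" using assms by blast
  then have "K \<subseteq> L \<or> L \<subseteq> K" using assms(1) unfolding subset.chain_def by auto
  then show ?thesis using that KL by blast
qed

lemma subfield_of_Union_chain:
  assumes "\<C> \<noteq> {}" "subset.chain \<A> \<C>" "\<And>K. K \<in> \<C> \<Longrightarrow> subfield_of K"
  shows "subfield_of (\<Union>\<C>)"
proof -
  note dir = chain_directed[OF assms(2)]
  show ?thesis
  proof (rule subfield_ofI_ring)
    show "0 \<in> \<Union>\<C>" "1 \<in> \<Union>\<C>"
      using assms(1) subfield_of_closed(1,2)[OF assms(3)] by blast+
    show "x + y \<in> \<Union>\<C>" if "x \<in> \<Union>\<C>" "y \<in> \<Union>\<C>" for x y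
    proof -
      obtain K where K: "K \<in> \<C>" "x \<in> K" "y \<in> K" using dir[OF \<open>x \<in> \<Union>\<C>\<close> \<open>y \<in> \<Union>\<C>\<close>] by blast
      then show ?thesis using subfield_of_closed(3)[OF assms(3)] by blast
    qed
    show "x * y \<in> \<Union>\<C>" if "x \<in> \<Union>\<C>" "y \<in> \<Union>\<C>" for x y
    proof -
      obtain K where K: "K \<in> \<C>" "x \<in> K" "y \<in> K" using dir[OF \<open>x \<in> \<Union>\<C>\<close> \<open>y \<in> \<Union>\<C>\<close>] by blast
      then show ?thesis using subfield_of_closed(6)[OF assms(3)] by blast
    qed
    show "- x \<in> \<Union>\<C>" if "x \<in> \<Union>\<C>" for x
      using that subfield_of_closed(5)[OF assms(3)] by blast
    show "inverse x \<in> \<Union>\<C>" if "x \<in> \<Union>\<C>" for x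
      using that subfield_of_closed(7)[OF assms(3)] by blast
  qed
qed

lemma quad_constructible_subset:
  assumes "subfield_of K" "F \<subseteq> K" "\<And>y. y * y \<in> K \<Longrightarrow> y \<in> K"
  shows "quad_constructible F \<subseteq> K"
proof
  fix x assume "x \<in> quad_constructible F"
  then show "x \<in> K"
  proof induction
    case (base x)
    then show ?case using assms(2) by blast
  next
    case (sqrt y)
    show ?case by (rule assms(3)[OF sqrt.IH])
  qed (simp_all add: subfield_of_closed[OF assms(1)])
qed

text \<open>Encoded as a graph, not as a function with a domain: extension is then inclusion and the
  limit of a chain is its union, as Zorn's lemma wants.\<close>

definition partial_auto :: "'a::field set \<Rightarrow> ('a \<times> 'a) set \<Rightarrow> bool" where
  "partial_auto F g \<longleftrightarrow> single_valued g \<and> (\<forall>x\<in>F. (x, x) \<in> g) \<and>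
     (\<forall>x x' y y'. (x, x') \<in> g \<longrightarrow> (y, y') \<in> g \<longrightarrow> (x + y, x' + y') \<in> g \<and> (x * y, x' * y') \<in> g) \<and>
     (\<forall>x x'. (x, x') \<in> g \<longrightarrow> (- x, - x') \<in> g \<and> (inverse x, inverse x') \<in> g)"

lemma partial_autoD:
  assumes "partial_auto F g"
  shows "(x, x') \<in> g \<Longrightarrow> (x, x'') \<in> g \<Longrightarrow> x' = x''"
    and "x \<in> F \<Longrightarrow> (x, x) \<in> g"
    and "(x, x') \<in> g \<Longrightarrow> (y, y') \<in> g \<Longrightarrow> (x + y, x' + y') \<in> g"
    and "(x, x') \<in> g \<Longrightarrow> (y, y') \<in> g \<Longrightarrow> (x * y, x' * y') \<in> g"
    and "(x, x') \<in> g \<Longrightarrow> (- x, - x') \<in> g"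
    and "(x, x') \<in> g \<Longrightarrow> (inverse x, inverse x') \<in> g"
    and "(x, x') \<in> g \<Longrightarrow> (y, y') \<in> g \<Longrightarrow> (x - y, x' - y') \<in> g"
proof -
  show add: "(x, x') \<in> g \<Longrightarrow> (y, y') \<in> g \<Longrightarrow> (x + y, x' + y') \<in> g" for x x' y y'
    using assms unfolding partial_auto_def by simp
  show neg: "(x, x') \<in> g \<Longrightarrow> (- x, - x') \<in> g" for x x'
    using assms unfolding partial_auto_def by simp
  show "(x, x') \<in> g \<Longrightarrow> (x, x'') \<in> g \<Longrightarrow> x' = x''"
    using assms unfolding partial_auto_def by (meson single_valuedD)
  show "x \<in> F \<Longrightarrow> (x, x) \<in> g"
    "(x, x') \<in> g \<Longrightarrow> (y, y') \<in> g \<Longrightarrow> (x * y, x' * y') \<in> g"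
    "(x, x') \<in> g \<Longrightarrow> (inverse x, inverse x') \<in> g"
    using assms unfolding partial_auto_def by simp_all
  show "(x, x') \<in> g \<Longrightarrow> (y, y') \<in> g \<Longrightarrow> (x - y, x' - y') \<in> g"
    using add neg by fastforce
qed

lemma partial_auto_Id_on:
  assumes "subfield_of K" "F \<subseteq> K"
  shows "partial_auto F (Id_on K)"
  using assms subfield_of_closed[OF assms(1)] unfolding partial_auto_def single_valued_def
  by (auto simp: Id_on_iff)

lemma subfield_of_Domain:
  assumes "partial_auto F g" "subfield_of F"
  shows "subfield_of (Domain g)"
proof (rule subfield_ofI_ring)
  show "0 \<in> Domain g" "1 \<in> Domain g"
    using partial_autoD(2)[OF assms(1)] subfield_of_closed(1,2)[OF assms(2)] by blast+
  show "x + y \<in> Domain g" if "x \<in> Domain g" "y \<in> Domain g" for x y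
    using that partial_autoD(3)[OF assms(1)] by blast
  show "x * y \<in> Domain g" if "x \<in> Domain g" "y \<in> Domain g" for x y
    using that partial_autoD(4)[OF assms(1)] by blast
  show "- x \<in> Domain g" if "x \<in> Domain g" for x
    using that partial_autoD(5)[OF assms(1)] by blast
  show "inverse x \<in> Domain g" if "x \<in> Domain g" for x
    using that partial_autoD(6)[OF assms(1)] by blast
qed

text \<open>One construction for three purposes: \<open>y'\<close> is a root of the image of
  \<open>y * y\<close> when an automorphism is extended, \<open>- y\<close> for the conjugation of a
  quadratic extension, and \<open>y\<close> itself when only the field generated by \<open>y\<close>
  is wanted.\<close>

definition adjoin :: "('a::field \<times> 'a) set \<Rightarrow> 'a \<Rightarrow> 'a \<Rightarrow> ('a \<times> 'a) set" where
  "adjoin g y y' = {(a + b * y, a' + b' * y') | a a' b b'. (a, a') \<in> g \<and> (b, b') \<in> g}"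

lemma adjoinI:
  "(a, a') \<in> g \<Longrightarrow> (b, b') \<in> g \<Longrightarrow> x = a + b * y \<Longrightarrow> x' = a' + b' * y' \<Longrightarrow> (x, x') \<in> adjoin g y y'"
  unfolding adjoin_def by blast

lemma subset_adjoin:
  assumes "partial_auto F g" "subfield_of F"
  shows "g \<subseteq> adjoin g y y'" "(y, y') \<in> adjoin g y y'"
proof -
  have g01: "(0, 0) \<in> g" "(1, 1) \<in> g"
    using partial_autoD(2)[OF assms(1)] subfield_of_closed(1,2)[OF assms(2)] by auto
  show "g \<subseteq> adjoin g y y'"
    using g01 by (auto intro: adjoinI)
  show "(y, y') \<in> adjoin g y y'"
    by (rule adjoinI[OF g01]) auto
qed

text \<open>As \<open>y\<close> lies outside the field \<open>Domain g\<close>, the elements 1 and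
  \<open>y\<close> are independent over it, so coordinates are unique and the relation stays
  single-valued. The second hypothesis on \<open>y\<close> makes it multiplicative.\<close>

lemma partial_auto_adjoin:
  assumes g: "partial_auto F g" and F: "subfield_of F"
    and y: "y \<notin> Domain g" and yy: "(y * y, y' * y') \<in> g"
  shows "partial_auto F (adjoin g y y')"
proof -
  note D = partial_autoD[OF g]
  have g0: "(0, 0) \<in> g"
    using D(2) subfield_of_closed(1)[OF F] by auto
  have indep: "a = 0 \<and> b = 0" if "a \<in> Domain g" "b \<in> Domain g" "a + b * y = 0" for a b
  proof -
    have "b = 0"
    proof (rule ccontr)
      assume b: "b \<noteq> 0"
      with that(3) have "y = - a * inverse b"
        by (simp add: field_simps eq_neg_iff_add_eq_0)
      moreover have "- a * inverse b \<in> Domain g"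
        using that subfield_of_closed(5-7)[OF subfield_of_Domain[OF g F]] by simp
      ultimately show False using y by simp
    qed
    with that show ?thesis by simp
  qed
  have nz: "x' \<noteq> 0" if "(x, x') \<in> g" "x \<noteq> 0" for x x'
  proof
    assume "x' = 0"
    with D(4)[OF D(6)[OF that(1)] that(1)] that(2) have "(1, 0) \<in> g" by simp
    then show False using D(1)[of 1 1 0] D(2)[of 1] subfield_of_closed(2)[OF F] by simp
  qed
  show ?thesis
    unfolding partial_auto_def
  proof (intro conjI allI impI ballI)
    show "single_valued (adjoin g y y')"
    proof (rule single_valuedI)
      fix x u v assume "(x, u) \<in> adjoin g y y'" "(x, v) \<in> adjoin g y y'"
      then obtain a a' b b' c c' d d' where *: "(a, a') \<in> g" "(b, b') \<in> g" "(c, c') \<in> g" "(d, d') \<in> g"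
        "x = a + b * y" "x = c + d * y" "u = a' + b' * y'" "v = c' + d' * y'"
        unfolding adjoin_def by blast
      have "a - c = 0 \<and> b - d = 0"
      proof (rule indep)
        show "a - c \<in> Domain g" "b - d \<in> Domain g" using D(7) * by blast+
        show "a - c + (b - d) * y = 0" using *(5,6) by (simp add: algebra_simps)
      qed
      then have "a = c" "b = d" by auto
      then have "a' = c'" "b' = d'" using * D(1)[of a a' c'] D(1)[of b b' d'] by auto
      then show "u = v" using * by simp
    qed
    show "(x, x) \<in> adjoin g y y'" if "x \<in> F" for x
      using subset_adjoin(1)[OF g F] D(2)[OF that] by blast
    fix x x' z z'
    assume x: "(x, x') \<in> adjoin g y y'"
    then obtain a a' b b' where ab: "(a, a') \<in> g" "(b, b') \<in> g" "x = a + b * y" "x' = a' + b' * y'"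
      unfolding adjoin_def by blast
    show "(- x, - x') \<in> adjoin g y y'"
      by (rule adjoinI[OF D(5)[OF ab(1)] D(5)[OF ab(2)]]) (auto simp: ab)
    show "(inverse x, inverse x') \<in> adjoin g y y'"
    proof (cases "x = 0")
      case True
      then have "a = 0" "b = 0" using indep[of a b] ab by auto
      then have "a' = 0" "b' = 0" using ab g0 D(1)[of 0 _ 0] by auto
      then have "x' = 0" using ab by simp
      then show ?thesis using True g0 subset_adjoin(1)[OF g F] by auto
    next
      case False
      \<comment> \<open>The norm of \<open>x\<close> and its counterpart for \<open>x'\<close>: the
        inverse of \<open>x\<close> is its conjugate divided by the norm, which lies in the base
        field.\<close>
      define n n' where "n = a * a - b * b * (y * y)" and "n' = a' * a' - b' * b' * (y' * y')"
      have n: "(n, n') \<in> g" unfolding n_def n'_def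
        by (rule D(7)[OF D(4)[OF ab(1) ab(1)] D(4)[OF D(4)[OF ab(2) ab(2)] yy]])
      have fac: "n = x * (a - b * y)" "n' = x' * (a' - b' * y')"
        unfolding n_def n'_def ab by (simp_all add: algebra_simps)
      have "a - b * y \<noteq> 0"
      proof
        assume "a - b * y = 0"
        then have "a = 0 \<and> - b = 0" using indep[of a "-b"] ab(1) D(5)[OF ab(2)] by auto
        then show False using \<open>x \<noteq> 0\<close> ab by simp
      qed
      then have "n \<noteq> 0" using fac False by simp
      moreover from this have "n' \<noteq> 0" using n nz by blast
      ultimately have inv: "inverse x = (a - b * y) * inverse n" "inverse x' = (a' - b' * y') * inverse n'"
        using fac by (auto simp: field_simps)
      show ?thesis
        by (rule adjoinI[OF D(4)[OF ab(1) D(6)[OF n]] D(4)[OF D(5)[OF ab(2)] D(6)[OF n]]])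
          (auto simp: inv algebra_simps)
    qed
    assume "(z, z') \<in> adjoin g y y'"
    then obtain c c' d d' where cd: "(c, c') \<in> g" "(d, d') \<in> g" "z = c + d * y" "z' = c' + d' * y'"
      unfolding adjoin_def by blast
    show "(x + z, x' + z') \<in> adjoin g y y'"
      by (rule adjoinI[OF D(3)[OF ab(1) cd(1)] D(3)[OF ab(2) cd(2)]]) (auto simp: ab cd algebra_simps)
    show "(x * z, x' * z') \<in> adjoin g y y'"
      by (rule adjoinI[OF D(3)[OF D(4)[OF ab(1) cd(1)] D(4)[OF D(4)[OF ab(2) cd(2)] yy]]
            D(3)[OF D(4)[OF ab(1) cd(2)] D(4)[OF ab(2) cd(1)]]])
        (auto simp: ab cd algebra_simps)
  qed
qed

lemma partial_auto_Union_chain: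
  assumes "\<C> \<noteq> {}" "subset.chain \<A> \<C>" "\<And>g. g \<in> \<C> \<Longrightarrow> partial_auto F g"
  shows "partial_auto F (\<Union>\<C>)"
proof -
  note dir = chain_directed[OF assms(2)]
  show ?thesis
    unfolding partial_auto_def
  proof (intro conjI allI impI ballI)
    show "single_valued (\<Union>\<C>)"
    proof (rule single_valuedI)
      fix x u v assume uv: "(x, u) \<in> \<Union>\<C>" "(x, v) \<in> \<Union>\<C>"
      obtain g where "g \<in> \<C>" "(x, u) \<in> g" "(x, v) \<in> g" using dir[OF uv] by blast
      then show "u = v" using partial_autoD(1)[OF assms(3)] by blast
    qed
    show "(x, x) \<in> \<Union>\<C>" if "x \<in> F" for x
      using assms(1) partial_autoD(2)[OF assms(3) that] by blast
    fix x x' y y'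
    assume x: "(x, x') \<in> \<Union>\<C>"
    show "(- x, - x') \<in> \<Union>\<C>" "(inverse x, inverse x') \<in> \<Union>\<C>"
      using x partial_autoD(5,6)[OF assms(3)] by blast+
    assume y: "(y, y') \<in> \<Union>\<C>"
    show "(x + y, x' + y') \<in> \<Union>\<C>" "(x * y, x' * y') \<in> \<Union>\<C>"
    proof -
      obtain g where g: "g \<in> \<C>" "(x, x') \<in> g" "(y, y') \<in> g" using dir[OF x y] by blast
      show "(x + y, x' + y') \<in> \<Union>\<C>" "(x * y, x' * y') \<in> \<Union>\<C>"
        using partial_autoD(3,4)[OF assms(3) g(2,3)] g(1) by blast+
    qed
  qed
qed

text \<open>Formal reality is kept out of the locale: it enters only to exclude characteristic two
  and to produce an involution. The rest holds whenever 2 is invertible.\<close>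

locale quadratic_closure =
  fixes F :: "'a::field set"
  assumes subfield: "subfield_of F"
    and closure: "is_quadratic_closure F"
    and two_neq_0: "(2::'a) \<noteq> 0"
begin

lemma ex_sqrt: "\<exists>y. y * y = (x::'a)"
  using closure unfolding is_quadratic_closure_def by blast

text \<open>The way in which the quadratic closure is exploited: a subfield, usually attached to a
  Zorn-maximal object, is everything once square roots cannot leave it.\<close>

lemma sqrt_closed_imp_UNIV:
  assumes "subfield_of K" "F \<subseteq> K" "\<And>y. y * y \<in> K \<Longrightarrow> y \<in> K"
  shows "K = UNIV"
  using quad_constructible_subset[OF assms] closure unfolding is_quadratic_closure_def by auto

lemma mem_Gal_iff:
  "\<sigma> \<in> carrier (Gal F) \<longleftrightarrow> field_auto \<sigma> \<and> (\<forall>x\<in>F. \<sigma> x = x)"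
  by (simp add: Gal_def)

lemma Gal_hom:
  assumes "\<sigma> \<in> carrier (Gal F)"
  shows "\<sigma> (x + y) = \<sigma> x + \<sigma> y" "\<sigma> (x * y) = \<sigma> x * \<sigma> y" "\<sigma> 0 = 0" "\<sigma> 1 = 1"
    "\<sigma> (- x) = - \<sigma> x" "\<sigma> (x - y) = \<sigma> x - \<sigma> y" "\<sigma> x = \<sigma> y \<longleftrightarrow> x = y" "bij \<sigma>"
proof -
  have \<sigma>: "field_auto \<sigma>" using assms mem_Gal_iff by blast
  show add: "\<sigma> (x + y) = \<sigma> x + \<sigma> y" for x y using \<sigma> unfolding field_auto_def by blast
  show "\<sigma> (x * y) = \<sigma> x * \<sigma> y" "\<sigma> 1 = 1" "bij \<sigma>" using \<sigma> unfolding field_auto_def by blast+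
  then show "\<sigma> x = \<sigma> y \<longleftrightarrow> x = y" by (simp add: bij_def inj_eq)
  show 0: "\<sigma> 0 = 0" using add[of 0 0] by (metis add.right_neutral add_left_cancel)
  show neg: "\<sigma> (- x) = - \<sigma> x" for x using add[of x "-x"] 0 by (metis add.right_inverse minus_unique)
  show "\<sigma> (x - y) = \<sigma> x - \<sigma> y" using add[of x "-y"] neg by simp
qed

lemma square_eq_cases: "x * x = y * y \<Longrightarrow> x = y \<or> x = - (y::'a)"
  by (simp add: square_eq_iff)

text \<open>A maximal extension of \<open>g\<close> has a domain closed under square roots, since a
  missing root could be adjoined and sent to any root of the image of its square.\<close>

lemma partial_auto_extends:
  assumes "partial_auto F g"
  obtains \<sigma> where "\<sigma> \<in> carrier (Gal F)" "\<And>x x'. (x, x') \<in> g \<Longrightarrow> \<sigma> x = x'"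
proof -
  obtain M where M: "partial_auto F M" "g \<subseteq> M"
    and max: "\<And>h. partial_auto F h \<Longrightarrow> M \<subseteq> h \<Longrightarrow> h = M"
  proof (rule maximal_superset[where P = "partial_auto F" and S = g])
    show "partial_auto F g" by fact
    show "partial_auto F (\<Union>\<C>)" if "\<C> \<noteq> {}" "subset.chain {h. partial_auto F h} \<C>"
      "\<And>h. h \<in> \<C> \<Longrightarrow> partial_auto F h" for \<C>
      using that by (rule partial_auto_Union_chain)
  qed (rule that)
  note D = partial_autoD[OF M(1)]
  have "Domain M = UNIV"
  proof (rule sqrt_closed_imp_UNIV[OF subfield_of_Domain[OF M(1) subfield]])
    show "F \<subseteq> Domain M" using D(2) by blast
    fix y assume "y * y \<in> Domain M"
    then obtain d where "(y * y, d) \<in> M" by blast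
    moreover obtain y' where "y' * y' = d" using ex_sqrt by blast
    ultimately have yy: "(y * y, y' * y') \<in> M" by simp
    show "y \<in> Domain M"
    proof (rule ccontr)
      assume y: "y \<notin> Domain M"
      have "adjoin M y y' = M"
        using max partial_auto_adjoin[OF M(1) subfield y yy] subset_adjoin(1)[OF M(1) subfield] by blast
      then show False using y subset_adjoin(2)[OF M(1) subfield] by blast
    qed
  qed
  then have "\<forall>x. \<exists>x'. (x, x') \<in> M" by blast
  then obtain \<sigma> where \<sigma>: "\<And>x. (x, \<sigma> x) \<in> M" by metis
  have eq: "x' = \<sigma> x" if "(x, x') \<in> M" for x x' using D(1)[OF that \<sigma>] .
  have hom: "\<sigma> (x + y) = \<sigma> x + \<sigma> y" "\<sigma> (x * y) = \<sigma> x * \<sigma> y" "\<sigma> (- x) = - \<sigma> x"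
    "\<sigma> (inverse x) = inverse (\<sigma> x)" "\<sigma> (x - y) = \<sigma> x - \<sigma> y" for x y
    using eq[OF D(3)[OF \<sigma> \<sigma>]] eq[OF D(4)[OF \<sigma> \<sigma>]] eq[OF D(5)[OF \<sigma>]] eq[OF D(6)[OF \<sigma>]]
      eq[OF D(7)[OF \<sigma> \<sigma>]] by simp_all
  have fixed: "\<sigma> x = x" if "x \<in> F" for x using eq[OF D(2)[OF that]] by simp
  have 01: "\<sigma> 0 = 0" "\<sigma> 1 = 1" using fixed subfield_of_closed(1,2)[OF subfield] by auto
  have "inj \<sigma>"
  proof (rule injI, rule ccontr)
    fix x y assume *: "\<sigma> x = \<sigma> y" "x \<noteq> y"
    have "\<sigma> ((x - y) * inverse (x - y)) = 0" unfolding hom using *(1) by simp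
    then show False using * 01 by simp
  qed
  \<comment> \<open>Surjectivity comes from the same principle: if \<open>y * y\<close> is the image
    of a square, then \<open>y\<close> is, up to sign, the image of its root.\<close>
  moreover have "range \<sigma> = UNIV"
  proof (rule sqrt_closed_imp_UNIV)
    show "subfield_of (range \<sigma>)"
    proof (rule subfield_ofI_ring)
      show "0 \<in> range \<sigma>" "1 \<in> range \<sigma>" using 01 by (metis rangeI)+
    qed (auto simp flip: hom)
    show "F \<subseteq> range \<sigma>" using fixed by (metis rangeI subsetI)
    fix y assume "y * y \<in> range \<sigma>"
    then obtain z where z: "y * y = \<sigma> z" by blast
    obtain w where w: "w * w = z" using ex_sqrt by blast
    have "y * y = \<sigma> w * \<sigma> w" using z w hom(2) by metis
    then have "y = \<sigma> w \<or> y = \<sigma> (- w)" using square_eq_cases hom(3) by metis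
    then show "y \<in> range \<sigma>" by blast
  qed
  ultimately have "field_auto \<sigma>"
    unfolding field_auto_def bij_def using hom 01 by blast
  then show ?thesis
    using that[of \<sigma>] fixed eq M(2) mem_Gal_iff by blast
qed

lemma ex_sqrt_outside:
  assumes "subfield_of K" "F \<subseteq> K" "K \<noteq> UNIV"
  obtains y where "y \<notin> K" "y * y \<in> K"
  using sqrt_closed_imp_UNIV[OF assms(1,2)] assms(3) by blast

lemma adjoin_conjugation:
  assumes K: "subfield_of K" "F \<subseteq> K" and y: "y \<notin> K" "y * y \<in> K"
  obtains \<sigma> where "\<sigma> \<in> carrier (Gal F)" "\<And>a. a \<in> K \<Longrightarrow> \<sigma> a = a" "\<sigma> y = - y"
proof -
  have pa: "partial_auto F (Id_on K)" by (rule partial_auto_Id_on[OF K])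
  have "partial_auto F (adjoin (Id_on K) y (- y))"
    by (rule partial_auto_adjoin[OF pa subfield]) (use y in auto)
  then obtain \<sigma> where \<sigma>: "\<sigma> \<in> carrier (Gal F)" "\<And>x x'. (x, x') \<in> adjoin (Id_on K) y (- y) \<Longrightarrow> \<sigma> x = x'"
    using partial_auto_extends by blast
  show ?thesis
    by (rule that[OF \<sigma>(1)]) (use \<sigma>(2) subset_adjoin[OF pa subfield] in blast)+
qed

lemma subset_adjoin_field:
  assumes "subfield_of K"
  shows "K \<subseteq> {a + b * y | a b. a \<in> K \<and> b \<in> K}" "y \<in> {a + b * y | a b. a \<in> K \<and> b \<in> K}"
proof -
  note K = subfield_of_closed(1,2)[OF assms]
  show "K \<subseteq> {a + b * y | a b. a \<in> K \<and> b \<in> K}"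
  proof
    fix x assume "x \<in> K"
    moreover have "x = x + 0 * y" by simp
    ultimately show "x \<in> {a + b * y | a b. a \<in> K \<and> b \<in> K}" using K(1) by blast
  qed
  have "y = 0 + 1 * y" by simp
  then show "y \<in> {a + b * y | a b. a \<in> K \<and> b \<in> K}"
    using K by blast
qed

lemma subfield_of_adjoin:
  assumes K: "subfield_of K" "F \<subseteq> K" and y: "y * y \<in> K"
  shows "subfield_of {a + b * y | a b. a \<in> K \<and> b \<in> K}"
proof (cases "y \<in> K")
  case True
  have "{a + b * y | a b. a \<in> K \<and> b \<in> K} = K"
    by (rule equalityI[OF _ subset_adjoin_field(1)[OF K(1)]])
      (use True subfield_of_closed(3,6)[OF K(1)] in auto)
  then show ?thesis using K by simp
next
  case False
  have pa: "partial_auto F (Id_on K)" by (rule partial_auto_Id_on[OF K])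
  have "partial_auto F (adjoin (Id_on K) y y)"
    by (rule partial_auto_adjoin[OF pa subfield]) (use y False in auto)
  then have "subfield_of (Domain (adjoin (Id_on K) y y))"
    using subfield_of_Domain subfield by blast
  moreover have "Domain (adjoin (Id_on K) y y) = {a + b * y | a b. a \<in> K \<and> b \<in> K}"
    unfolding adjoin_def Domain_unfold Id_on_iff by blast
  ultimately show ?thesis by simp
qed

text \<open>Let K be maximal among the intermediate fields missing \<alpha>. Every proper quadratic
  extension K(y) contains \<alpha>, but the automorphism over K sending y to -y moves all elements
  of K(y) outside K, because 2 is invertible.\<close>

lemma fixed_by_Gal_imp_mem:
  assumes "\<And>\<sigma>. \<sigma> \<in> carrier (Gal F) \<Longrightarrow> \<sigma> \<alpha> = \<alpha>"
  shows "\<alpha> \<in> F"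
proof (rule ccontr)
  assume \<alpha>: "\<alpha> \<notin> F"
  let ?P = "\<lambda>K. subfield_of K \<and> F \<subseteq> K \<and> \<alpha> \<notin> K"
  obtain K where P: "?P K" "F \<subseteq> K" and max: "\<And>K'. ?P K' \<Longrightarrow> K \<subseteq> K' \<Longrightarrow> K' = K"
  proof (rule maximal_superset[where P = ?P and S = F])
    show "?P F" using \<alpha> subfield by blast
    fix \<C> assume C: "\<C> \<noteq> {}" "subset.chain {K. ?P K} \<C>" and all: "\<And>K. K \<in> \<C> \<Longrightarrow> ?P K"
    have "subfield_of (\<Union>\<C>)"
      by (rule subfield_of_Union_chain[OF C]) (use all in auto)
    then show "?P (\<Union>\<C>)" using C(1) all by blast
  qed (rule that)
  then have K: "subfield_of K" "F \<subseteq> K" "\<alpha> \<notin> K" by auto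
  obtain y where y: "y \<notin> K" "y * y \<in> K" using ex_sqrt_outside[OF K(1,2)] K(3) by blast
  have "\<alpha> \<in> {a + b * y | a b. a \<in> K \<and> b \<in> K}" (is "_ \<in> ?K'")
  proof (rule ccontr)
    assume "\<alpha> \<notin> ?K'"
    then have "?P ?K'"
      using subfield_of_adjoin[OF K(1,2) y(2)] subset_adjoin_field(1)[OF K(1), of y] K(2) by simp
    from max[OF this subset_adjoin_field(1)[OF K(1)]] have "y \<in> K"
      using subset_adjoin_field(2)[OF K(1), of y] by simp
    then show False using y(1) by simp
  qed
  then obtain a b where ab: "\<alpha> = a + b * y" "a \<in> K" "b \<in> K" by blast
  obtain \<sigma> where \<sigma>: "\<sigma> \<in> carrier (Gal F)" "\<And>a. a \<in> K \<Longrightarrow> \<sigma> a = a" "\<sigma> y = - y"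
    using adjoin_conjugation[OF K(1,2) y] by blast
  have "a + b * y = a - b * y"
    using assms[OF \<sigma>(1)] \<sigma>(2,3) ab Gal_hom(1,2)[OF \<sigma>(1)] by simp
  then have "2 * (b * y) = 0" by (simp add: algebra_simps)
  then have "b * y = 0" using two_neq_0 by simp
  with ab(1) have "\<alpha> = a" by (simp only: add_0_right)
  then show False using ab(2) K(3) by simp
qed

end

section \<open>Galois closure of subgroups\<close>

text \<open>Stated for commutative rings because it has to cover maps of the field as well as the
  maps they induce on polynomials in one and in two variables.\<close>

definition ring_endo :: "('a::comm_ring_1 \<Rightarrow> 'a) \<Rightarrow> bool" where
  "ring_endo h \<longleftrightarrow> h 0 = 0 \<and> h 1 = 1 \<and> (\<forall>x y. h (x + y) = h x + h y) \<and> (\<forall>x y. h (x * y) = h x * h y)"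

lemma ring_endoD:
  assumes "ring_endo h"
  shows "h 0 = 0" "h 1 = 1" "h (x + y) = h x + h y" "h (x * y) = h x * h y" "h (- x) = - h x"
proof -
  show "h 0 = 0" "h 1 = 1" "h (x + y) = h x + h y" "h (x * y) = h x * h y"
    using assms unfolding ring_endo_def by auto
  have "h (x + - x) = h x + h (- x)"
    using assms unfolding ring_endo_def by blast
  then show "h (- x) = - h x"
    using assms unfolding ring_endo_def by (simp add: minus_unique)
qed

lemma ring_endo_sum: "ring_endo h \<Longrightarrow> h (sum f A) = (\<Sum>x\<in>A. h (f x))"
  by (induction A rule: infinite_finite_induct) (simp_all add: ring_endoD)

lemma ring_endo_prod: "ring_endo h \<Longrightarrow> h (prod f A) = (\<Prod>x\<in>A. h (f x))"
  by (induction A rule: infinite_finite_induct) (simp_all add: ring_endoD)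

lemma ring_endo_map_poly:
  assumes "ring_endo h"
  shows "ring_endo (map_poly h)"
proof -
  note D = ring_endoD[OF assms]
  show ?thesis
    unfolding ring_endo_def
  proof (intro conjI allI)
    show "map_poly h 0 = 0" "map_poly h 1 = 1" by (simp_all add: D map_poly_1')
    show "map_poly h (p + q) = map_poly h p + map_poly h q" for p q
      by (rule poly_eqI) (simp add: coeff_map_poly D)
    show "map_poly h (p * q) = map_poly h p * map_poly h q" for p q
      by (rule poly_eqI) (simp add: coeff_map_poly D coeff_mult ring_endo_sum[OF assms])
  qed
qed

section \<open>Orbit polynomials and Artin's theorem for tuples\<close>

lemma map_poly_linear_factor:
  assumes "ring_endo h"
  shows "map_poly h [:- q, 1:] = [:- h q, 1:]"
  by (simp add: map_poly_pCons ring_endoD[OF assms])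

lemma inj_map_poly:
  assumes "inj h" "h 0 = (0::'a::comm_ring_1)"
  shows "inj (map_poly h)"
proof (rule injI)
  fix p q assume "map_poly h p = map_poly h q"
  then have "coeff (map_poly h p) n = coeff (map_poly h q) n" for n by simp
  then have "coeff p n = coeff q n" for n
    using assms by (simp add: coeff_map_poly inj_eq)
  then show "p = q" by (rule poly_eqI)
qed

text \<open>A map that fixes the coefficients of a polynomial sends roots to roots, and in an
  integral domain the roots of the product are exactly the elements of \<open>Q\<close>.\<close>

lemma mem_orbit_if_fixes_orbit_polynomial:
  fixes \<sigma> :: "'b::idom \<Rightarrow> 'b"
  assumes Q: "finite Q" "p \<in> Q" and \<sigma>: "ring_endo \<sigma>"
    and fixed: "map_poly \<sigma> (\<Prod>q\<in>Q. [:- q, 1:]) = (\<Prod>q\<in>Q. [:- q, 1:])"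
  shows "\<sigma> p \<in> Q"
proof -
  have "(\<Prod>q\<in>Q. [:- q, 1:]) = (\<Prod>q\<in>Q. [:- \<sigma> q, 1:])"
    using fixed unfolding ring_endo_prod[OF ring_endo_map_poly[OF \<sigma>]] map_poly_linear_factor[OF \<sigma>] by simp
  then have "poly (\<Prod>q\<in>Q. [:- q, 1:]) (\<sigma> p) = poly (\<Prod>q\<in>Q. [:- \<sigma> q, 1:]) (\<sigma> p)"
    by (simp only:)
  then have "(\<Prod>q\<in>Q. \<sigma> p - q) = (\<Prod>q\<in>Q. \<sigma> p - \<sigma> q)"
    unfolding poly_prod by simp
  also have "\<dots> = 0" using Q by auto
  finally show ?thesis using Q(1) by simp
qed

lemma map_poly_orbit_polynomial:
  fixes h :: "'b::idom \<Rightarrow> 'b"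
  assumes "ring_endo h" "inj h" "h ` Q = Q"
  shows "map_poly h (\<Prod>q\<in>Q. [:- q, 1:]) = (\<Prod>q\<in>Q. [:- q, 1:])"
proof -
  have "map_poly h (\<Prod>q\<in>Q. [:- q, 1:]) = (\<Prod>q\<in>Q. [:- h q, 1:])"
    using assms(1) by (simp only: ring_endo_prod[OF ring_endo_map_poly] map_poly_linear_factor)
  also have "\<dots> = (\<Prod>q\<in>h ` Q. [:- q, 1:])"
    using assms(2) by (subst prod.reindex) (auto simp: inj_on_def)
  finally show ?thesis using assms(3) by simp
qed

lemma coeff_map_poly_fixed:
  assumes "h 0 = 0" "map_poly h p = p"
  shows "h (coeff p i) = coeff p i"
  using assms by (metis coeff_map_poly)

lemma map_poly_Poly:
  assumes "h 0 = 0"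
  shows "map_poly h (Poly xs) = Poly (map h xs)"
  by (rule poly_eqI) (simp add: coeff_map_poly[where f=h] assms nth_default_def)

text \<open>\<open>Poly\<close> drops trailing zeros, so a tuple can be recovered only when its
  length is known.\<close>

lemma Poly_inj_length:
  assumes "Poly xs = Poly ys" "length xs = length ys"
  shows "xs = ys"
proof (rule nth_equalityI[OF assms(2)])
  fix i assume i: "i < length xs"
  have "coeff (Poly xs) i = coeff (Poly ys) i" using assms(1) by simp
  then show "xs ! i = ys ! i" using i assms(2) by (simp add: nth_default_def)
qed

text \<open>Artin's theorem without primitive elements: a tuple is encoded as a polynomial in one variable,
  whose orbit polynomial, in a second variable, has coefficients fixed by the whole group.\<close>
lemma agrees_on_list_if_fixes_fixed_elements:
  fixes H :: "('a::field \<Rightarrow> 'a) set"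
  assumes H: "\<And>h. h \<in> H \<Longrightarrow> ring_endo h \<and> inj h" "id \<in> H"
      "\<And>g h. g \<in> H \<Longrightarrow> h \<in> H \<Longrightarrow> g \<circ> h \<in> H"
    and orbit: "\<And>x. finite ((\<lambda>h. h x) ` H)"
    and \<sigma>: "ring_endo \<sigma>" "\<And>x. (\<And>h. h \<in> H \<Longrightarrow> h x = x) \<Longrightarrow> \<sigma> x = x"
  shows "\<exists>h\<in>H. map h xs = map \<sigma> xs"
proof -
  define Q where "Q = (\<lambda>h. Poly (map h xs)) ` H"
  have "(\<lambda>h. map h xs) ` H \<subseteq> {ys. set ys \<subseteq> (\<Union>x\<in>set xs. (\<lambda>h. h x) ` H) \<and> length ys = length xs}"
    by fastforce
  moreover have "finite (\<Union>x\<in>set xs. (\<lambda>h. h x) ` H)" using orbit by blast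
  ultimately have "finite ((\<lambda>h. map h xs) ` H)"
    using finite_lists_length_eq finite_subset by blast
  then have "finite (Poly ` (\<lambda>h. map h xs) ` H)" by (rule finite_imageI)
  then have finO: "finite Q" unfolding Q_def image_image .
  have mp: "map_poly h (Poly ys) = Poly (map h ys)" if "ring_endo h" for h :: "'a \<Rightarrow> 'a" and ys
    using map_poly_Poly ring_endoD(1)[OF that] by blast
  let ?R = "\<Prod>q\<in>Q. [:- q, 1:]"
  have fixedR: "map_poly (map_poly h) ?R = ?R" if h: "h \<in> H" for h
  proof (rule map_poly_orbit_polynomial)
    show "ring_endo (map_poly h)" "inj (map_poly h)"
      using H(1)[OF h] ring_endo_map_poly inj_map_poly ring_endoD(1) by blast+
    \<comment> \<open>Inclusion is enough: an injective map of a finite set into itself is onto, so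
      inverses in \<open>H\<close> are not called for.\<close>
    have "map_poly h ` Q \<subseteq> Q"
    proof
      fix p assume "p \<in> map_poly h ` Q"
      then obtain g where g: "g \<in> H" "p = map_poly h (Poly (map g xs))" unfolding Q_def by blast
      have "p = Poly (map (h \<circ> g) xs)" using g(2) mp H(1)[OF h] by simp
      then show "p \<in> Q" unfolding Q_def using H(3)[OF h g(1)] by blast
    qed
    then show "map_poly h ` Q = Q"
      using finO \<open>inj (map_poly h)\<close> by (metis endo_inj_surj inj_on_subset subset_UNIV)
  qed
  \<comment> \<open>The field elements inside the two-variable polynomial \<open>?R\<close> are
    fixed by all of \<open>H\<close>, which is what the hypothesis on \<sigma> can be applied
    to.\<close>
  have "\<sigma> (coeff (coeff ?R i) j) = coeff (coeff ?R i) j" for i j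
  proof (rule \<sigma>(2))
    fix h assume h: "h \<in> H"
    have 0: "h 0 = 0" using H(1)[OF h] ring_endoD(1) by blast
    then have "map_poly h 0 = 0" by simp
    from coeff_map_poly_fixed[OF this fixedR[OF h]] 0
    show "h (coeff (coeff ?R i) j) = coeff (coeff ?R i) j"
      by (rule coeff_map_poly_fixed[rotated])
  qed
  then have "map_poly (map_poly \<sigma>) ?R = ?R"
    by (intro poly_eqI) (simp add: coeff_map_poly ring_endoD(1)[OF \<sigma>(1)])
  \<comment> \<open>The identity of \<open>H\<close> makes the tuple itself a root; its image under
    \<sigma> is then a root too, that is, the image under some \<open>h\<close> in
    \<open>H\<close>.\<close>
  moreover have "Poly (map id xs) \<in> Q" unfolding Q_def using H(2) by blast
  ultimately have "map_poly \<sigma> (Poly (map id xs)) \<in> Q"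
    by (intro mem_orbit_if_fixes_orbit_polynomial[OF finO _ ring_endo_map_poly[OF \<sigma>(1)]])
  then have "Poly (map \<sigma> xs) \<in> Q" using mp[OF \<sigma>(1)] by simp
  then obtain h where "h \<in> H" "Poly (map \<sigma> xs) = Poly (map h xs)" unfolding Q_def by blast
  then show ?thesis using Poly_inj_length[of "map \<sigma> xs" "map h xs"] by auto
qed

section \<open>Krull-closed subgroups and their fixed fields\<close>

context quadratic_closure
begin

lemma Gal_mult [simp]: "\<sigma> \<otimes>\<^bsub>Gal F\<^esub> \<tau> = \<sigma> \<circ> \<tau>" and Gal_one [simp]: "\<one>\<^bsub>Gal F\<^esub> = id"
  by (simp_all add: Gal_def)

lemma Gal_comp: "\<sigma> \<in> carrier (Gal F) \<Longrightarrow> \<tau> \<in> carrier (Gal F) \<Longrightarrow> \<sigma> \<circ> \<tau> \<in> carrier (Gal F)"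
  unfolding mem_Gal_iff field_auto_def by (auto intro: bij_comp)

lemma Gal_id: "id \<in> carrier (Gal F)"
  unfolding mem_Gal_iff field_auto_def by auto

lemma group_Gal: "group (Gal F)"
proof (rule groupI)
  fix \<sigma> assume \<sigma>: "\<sigma> \<in> carrier (Gal F)"
  let ?\<tau> = "inv_into UNIV \<sigma>"
  note hom = Gal_hom[OF \<sigma>]
  have inv: "\<sigma> (?\<tau> x) = x" "?\<tau> (\<sigma> x) = x" for x
    using hom(8) by (simp_all add: bij_is_surj surj_f_inv_f bij_is_inj)
  have "?\<tau> (x + y) = ?\<tau> x + ?\<tau> y" "?\<tau> (x * y) = ?\<tau> x * ?\<tau> y" for x y
    using hom(1,2)[of "?\<tau> x" "?\<tau> y"] inv by metis+
  moreover have "?\<tau> x = x" if "x \<in> F" for x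
    using \<sigma> that inv(2)[of x] unfolding mem_Gal_iff by simp
  moreover have "?\<tau> 1 = 1" using inv(2)[of 1] hom(4) by simp
  ultimately have "?\<tau> \<in> carrier (Gal F)"
    unfolding mem_Gal_iff field_auto_def using bij_imp_bij_inv[OF hom(8)] by blast
  moreover have "?\<tau> \<circ> \<sigma> = id" using inv by auto
  ultimately show "\<exists>\<tau>\<in>carrier (Gal F). \<tau> \<otimes>\<^bsub>Gal F\<^esub> \<sigma> = \<one>\<^bsub>Gal F\<^esub>" by auto
qed (simp_all add: Gal_comp Gal_id comp_assoc)

lemma Gal_inv:
  assumes "\<sigma> \<in> carrier (Gal F)"
  shows "inv\<^bsub>Gal F\<^esub> \<sigma> \<in> carrier (Gal F)" "(inv\<^bsub>Gal F\<^esub> \<sigma>) (\<sigma> x) = x" "\<sigma> ((inv\<^bsub>Gal F\<^esub> \<sigma>) x) = x"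
proof -
  show "inv\<^bsub>Gal F\<^esub> \<sigma> \<in> carrier (Gal F)" using assms group.inv_closed[OF group_Gal] by blast
  show "(inv\<^bsub>Gal F\<^esub> \<sigma>) (\<sigma> x) = x"
    using group.l_inv[OF group_Gal assms] by (simp add: fun_eq_iff)
  show "\<sigma> ((inv\<^bsub>Gal F\<^esub> \<sigma>) x) = x"
    using group.r_inv[OF group_Gal assms] by (simp add: fun_eq_iff)
qed

lemma Gal_inverse:
  assumes "\<sigma> \<in> carrier (Gal F)"
  shows "\<sigma> (inverse x) = inverse (\<sigma> x)"
proof (cases "x = 0")
  case False
  then have "\<sigma> x * \<sigma> (inverse x) = 1"
    using Gal_hom(2,4)[OF assms] by (metis right_inverse)
  then show ?thesis by (simp add: inverse_unique)
qed (simp add: Gal_hom(3)[OF assms])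

lemma Gal_ring_endo: "\<sigma> \<in> carrier (Gal F) \<Longrightarrow> ring_endo \<sigma>"
  unfolding ring_endo_def by (simp add: Gal_hom)

text \<open>Finite orbits stand in for finite-dimensional subextensions. In the only interesting
  case, the orbit of a square root consists of square roots of a finite orbit, and each element has
  at most two.\<close>

lemma finite_Gal_orbit: "finite ((\<lambda>\<sigma>. \<sigma> x) ` carrier (Gal F))"
proof -
  let ?orb = "\<lambda>x. (\<lambda>\<sigma>. \<sigma> x) ` carrier (Gal F)"
  have "x \<in> quad_constructible F" using closure unfolding is_quadratic_closure_def by simp
  then show ?thesis
  proof induction
    case (base x)
    then have "?orb x \<subseteq> {x}" by (auto simp: mem_Gal_iff)
    then show ?case by (rule finite_subset) simp
  next
    case (add x y)
    have "?orb (x + y) \<subseteq> (\<lambda>(a, b). a + b) ` (?orb x \<times> ?orb y)"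
      by (auto simp: Gal_hom(1))
    then show ?case by (rule finite_subset) (use add.IH in simp)
  next
    case (neg x)
    have "?orb (- x) \<subseteq> uminus ` ?orb x" by (auto simp: Gal_hom(5))
    then show ?case by (rule finite_subset) (use neg.IH in simp)
  next
    case (mult x y)
    have "?orb (x * y) \<subseteq> (\<lambda>(a, b). a * b) ` (?orb x \<times> ?orb y)"
      by (auto simp: Gal_hom(2))
    then show ?case by (rule finite_subset) (use mult.IH in simp)
  next
    case (inv x)
    have "?orb (inverse x) \<subseteq> inverse ` ?orb x" by (auto simp: Gal_inverse)
    then show ?case by (rule finite_subset) (use inv.IH in simp)
  next
    case (sqrt y)
    have "finite {z. z * z = c}" for c :: 'a
    proof -
      obtain w where "w * w = c" using ex_sqrt by blast
      then have "{z. z * z = c} \<subseteq> {w, - w}" using square_eq_cases by auto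
      then show ?thesis by (rule finite_subset) simp
    qed
    then have "finite (\<Union>c\<in>?orb (y * y). {z. z * z = c})" using sqrt.IH by blast
    moreover have "?orb y \<subseteq> (\<Union>c\<in>?orb (y * y). {z. z * z = c})"
      by (auto simp: Gal_hom(2))
    ultimately show ?case using finite_subset by blast
  qed
qed

lemma generate_fixes:
  assumes "S \<subseteq> carrier (Gal F)" "\<And>s. s \<in> S \<Longrightarrow> s x = x" "h \<in> generate (Gal F) S"
  shows "h x = x"
  using assms(3)
proof induction
  case (inv s)
  then show ?case using assms(1,2) Gal_inv(2) by (metis subsetD)
qed (auto simp: assms(2))

text \<open>Closedness is tested on finite sets of points, so the harder inclusion is Artin's
  theorem for the tuple that lists such a set. The fixed elements of the generated group are those
  of \<open>S\<close>.\<close>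

lemma krull_closure_generate:
  assumes S: "S \<subseteq> carrier (Gal F)"
  shows "krull_closure F (generate (Gal F) S) =
    {\<sigma> \<in> carrier (Gal F). \<forall>x. (\<forall>s\<in>S. s x = x) \<longrightarrow> \<sigma> x = x}" (is "_ = ?R")
proof
  show "krull_closure F (generate (Gal F) S) \<subseteq> ?R"
  proof
    fix \<sigma> assume \<sigma>: "\<sigma> \<in> krull_closure F (generate (Gal F) S)"
    have "\<sigma> x = x" if "\<forall>s\<in>S. s x = x" for x
    proof -
      have "finite {x}" by simp
      then obtain s where "s \<in> generate (Gal F) S" "\<forall>z\<in>{x}. s z = \<sigma> z"
        using \<sigma> unfolding krull_closure_def by blast
      then show ?thesis using generate_fixes[OF S, of x s] that by auto
    qed
    then show "\<sigma> \<in> ?R" using \<sigma> unfolding krull_closure_def by simp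
  qed
  show "?R \<subseteq> krull_closure F (generate (Gal F) S)"
  proof
    fix \<sigma> assume \<sigma>: "\<sigma> \<in> ?R"
    have incl: "generate (Gal F) S \<subseteq> carrier (Gal F)"
      by (rule group.generate_incl[OF group_Gal S])
    have "\<exists>s\<in>generate (Gal F) S. \<forall>x\<in>D. s x = \<sigma> x" if D: "finite D" for D
    proof -
      obtain xs where xs: "set xs = D" using finite_list[OF D] by blast
      have "\<exists>h\<in>generate (Gal F) S. map h xs = map \<sigma> xs"
      proof (rule agrees_on_list_if_fixes_fixed_elements)
        show "ring_endo h \<and> inj h" if "h \<in> generate (Gal F) S" for h
          using that incl Gal_ring_endo Gal_hom(8) bij_is_inj by blast
        show "id \<in> generate (Gal F) S" using generate.one[of "Gal F" S] by simp
        show "g \<circ> h \<in> generate (Gal F) S"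
          if "g \<in> generate (Gal F) S" "h \<in> generate (Gal F) S" for g h
          using generate.eng[OF that] by simp
        show "finite ((\<lambda>h. h x) ` generate (Gal F) S)" for x
          by (rule finite_subset[OF image_mono[OF incl] finite_Gal_orbit])
        show "ring_endo \<sigma>" using \<sigma> Gal_ring_endo by blast
        show "\<sigma> x = x" if "\<And>h. h \<in> generate (Gal F) S \<Longrightarrow> h x = x" for x
          using \<sigma> that generate.incl[of _ S "Gal F"] by auto
      qed
      then show ?thesis unfolding xs[symmetric] by auto
    qed
    then show "\<sigma> \<in> krull_closure F (generate (Gal F) S)"
      using \<sigma> unfolding krull_closure_def by simp
  qed
qed

section \<open>The action on the elements fixed by all squares\<close>

definition sqrt_fixer :: "('a \<Rightarrow> 'a) set" where
  "sqrt_fixer = {\<sigma> \<in> carrier (Gal F). \<forall>y. y * y \<in> F \<longrightarrow> \<sigma> y = y}"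

text \<open>The fixed field of all squares in \<open>Gal F\<close>, on which the group acts with
  exponent two. The goal is that \<open>sqrt_fixer\<close> acts trivially on it.\<close>

definition square_fixed :: "'a set" where
  "square_fixed = {x. \<forall>g\<in>carrier (Gal F). g (g x) = x}"

lemma square_fixedD: "x \<in> square_fixed \<Longrightarrow> g \<in> carrier (Gal F) \<Longrightarrow> g (g x) = x"
  unfolding square_fixed_def by blast

text \<open>Conjugates of squares are squares: with k the inverse of h, k g g h is the square of k g
  h.\<close>

lemma square_fixed_stable:
  assumes "x \<in> square_fixed" "h \<in> carrier (Gal F)"
  shows "h x \<in> square_fixed"
  unfolding square_fixed_def
proof (intro CollectI ballI)
  fix g assume g: "g \<in> carrier (Gal F)"
  let ?k = "inv\<^bsub>Gal F\<^esub> h"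
  have "?k \<circ> (g \<circ> h) \<in> carrier (Gal F)"
    using Gal_comp g assms(2) Gal_inv(1) by blast
  from square_fixedD[OF assms(1) this] have "?k (g (g (h x))) = x"
    using Gal_inv(3)[OF assms(2)] by simp
  then show "g (g (h x)) = h x" using Gal_inv(3)[OF assms(2)] by metis
qed

text \<open>A group of exponent two is abelian; the argument runs pointwise, since the relations
  hold only on \<open>square_fixed\<close>.\<close>

lemma square_fixed_commute:
  assumes x: "x \<in> square_fixed" and g: "g \<in> carrier (Gal F)" and h: "h \<in> carrier (Gal F)"
  shows "g (h x) = h (g x)"
proof -
  have "g (h (g (h x))) = x" using square_fixedD[OF x Gal_comp[OF g h]] by simp
  then have "h (g (h x)) = g x"
    using square_fixedD[OF square_fixed_stable[OF square_fixed_stable[OF square_fixed_stable[OF x h] g] h] g]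
    by metis
  then show ?thesis
    using square_fixedD[OF square_fixed_stable[OF square_fixed_stable[OF x h] g] h] by metis
qed

text \<open>The Galois group acts on \<^term>\<open>square_fixed\<close> through commuting involutions; splitting an element
  into simultaneous eigenvectors for coset representatives of its stabiliser writes it as a
  sum of square roots of elements of \<^term>\<open>F\<close>.\<close>
lemma sqrt_fixer_fixes_square_fixed:
  assumes \<sigma>: "\<sigma> \<in> sqrt_fixer" and x: "x \<in> square_fixed"
  shows "\<sigma> x = x"
proof -
  have \<sigma>G: "\<sigma> \<in> carrier (Gal F)" using \<sigma> unfolding sqrt_fixer_def by blast
  \<comment> \<open>If \<beta> is fixed by the stabiliser of \<open>x\<close>, then
    \<open>g \<beta>\<close> depends only on \<open>g x\<close>. Finitely many automorphisms
    therefore control the whole orbit of \<beta>.\<close>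
  define P where "P \<beta> \<longleftrightarrow> \<beta> \<in> square_fixed \<and> (\<forall>t\<in>carrier (Gal F). t x = x \<longrightarrow> t \<beta> = \<beta>)" for \<beta>
  \<comment> \<open>The list holds the automorphisms still to be diagonalised. Removing
    \<open>g\<close> replaces \<beta> by its components \<beta> + g \<beta> and \<beta> - g \<beta>,
    which stay eigenvectors for the others because everything commutes, and whose sum is twice
    \<beta>.\<close>
  have split: "\<sigma> \<beta> = \<beta>"
    if "set gs \<subseteq> carrier (Gal F)"
      "\<And>\<beta>. P \<beta> \<Longrightarrow> (\<forall>g\<in>set gs. g \<beta> = \<beta> \<or> g \<beta> = - \<beta>) \<Longrightarrow> \<sigma> \<beta> = \<beta>" "P \<beta>" for gs \<beta>
    using that
  proof (induction gs arbitrary: \<beta>)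
    case Nil
    then show ?case by simp
  next
    case (Cons g gs)
    have g: "g \<in> carrier (Gal F)" and gs: "set gs \<subseteq> carrier (Gal F)" using Cons.prems(1) by auto
    show ?case
    proof (rule Cons.IH[OF gs _ Cons.prems(3)])
      fix \<beta> assume \<beta>: "P \<beta>" and eig: "\<forall>g\<in>set gs. g \<beta> = \<beta> \<or> g \<beta> = - \<beta>"
      have sf: "\<beta> \<in> square_fixed" using \<beta> unfolding P_def by blast
      have stable: "P (\<beta> + g \<beta>) \<and> P (\<beta> - g \<beta>)"
      proof -
        have "k (k (\<beta> + g \<beta>)) = \<beta> + g \<beta>" "k (k (\<beta> - g \<beta>)) = \<beta> - g \<beta>" if k: "k \<in> carrier (Gal F)" for k
          using square_fixedD[OF sf k] square_fixedD[OF square_fixed_stable[OF sf g] k]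
          by (simp_all add: Gal_hom(1,6)[OF k])
        moreover have "t (\<beta> + g \<beta>) = \<beta> + g \<beta>" "t (\<beta> - g \<beta>) = \<beta> - g \<beta>"
          if t: "t \<in> carrier (Gal F)" "t x = x" for t
        proof -
          have "t \<beta> = \<beta>" using \<beta> t unfolding P_def by blast
          then have "t (g \<beta>) = g \<beta>" using square_fixed_commute[OF sf t(1) g] by simp
          then show "t (\<beta> + g \<beta>) = \<beta> + g \<beta>" "t (\<beta> - g \<beta>) = \<beta> - g \<beta>"
            using \<open>t \<beta> = \<beta>\<close> by (simp_all add: Gal_hom(1,6)[OF t(1)])
        qed
        ultimately show ?thesis unfolding P_def square_fixed_def by simp
      qed
      have gg: "g (g \<beta>) = \<beta>" using square_fixedD[OF sf g] .
      have eig': "k (\<beta> + g \<beta>) = \<beta> + g \<beta> \<or> k (\<beta> + g \<beta>) = - (\<beta> + g \<beta>)"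
        "k (\<beta> - g \<beta>) = \<beta> - g \<beta> \<or> k (\<beta> - g \<beta>) = - (\<beta> - g \<beta>)" if k: "k \<in> set gs" for k
      proof -
        have kG: "k \<in> carrier (Gal F)" using k gs by blast
        have comm: "k (g \<beta>) = g (k \<beta>)" by (rule square_fixed_commute[OF sf kG g])
        consider "k \<beta> = \<beta>" | "k \<beta> = - \<beta>" using eig k by blast
        then have "k (\<beta> + g \<beta>) = \<beta> + g \<beta> \<and> k (\<beta> - g \<beta>) = \<beta> - g \<beta> \<or>
            k (\<beta> + g \<beta>) = - (\<beta> + g \<beta>) \<and> k (\<beta> - g \<beta>) = - (\<beta> - g \<beta>)"
          by cases (simp_all add: Gal_hom(1,6)[OF kG] comm Gal_hom(5)[OF g])
        then show "k (\<beta> + g \<beta>) = \<beta> + g \<beta> \<or> k (\<beta> + g \<beta>) = - (\<beta> + g \<beta>)"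
          "k (\<beta> - g \<beta>) = \<beta> - g \<beta> \<or> k (\<beta> - g \<beta>) = - (\<beta> - g \<beta>)" by blast+
      qed
      have "\<sigma> (\<beta> + g \<beta>) = \<beta> + g \<beta>"
      proof (rule Cons.prems(2))
        show "P (\<beta> + g \<beta>)" using stable by blast
        have "g (\<beta> + g \<beta>) = \<beta> + g \<beta>" by (simp add: Gal_hom(1)[OF g] gg add.commute)
        then show "\<forall>k\<in>set (g # gs). k (\<beta> + g \<beta>) = \<beta> + g \<beta> \<or> k (\<beta> + g \<beta>) = - (\<beta> + g \<beta>)"
          using eig'(1) by (metis set_ConsD)
      qed
      moreover have "\<sigma> (\<beta> - g \<beta>) = \<beta> - g \<beta>"
      proof (rule Cons.prems(2))
        show "P (\<beta> - g \<beta>)" using stable by blast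
        have "g (\<beta> - g \<beta>) = - (\<beta> - g \<beta>)" by (simp add: Gal_hom(6)[OF g] gg)
        then show "\<forall>k\<in>set (g # gs). k (\<beta> - g \<beta>) = \<beta> - g \<beta> \<or> k (\<beta> - g \<beta>) = - (\<beta> - g \<beta>)"
          using eig'(2) by (metis set_ConsD)
      qed
      ultimately have "(\<sigma> \<beta> + \<sigma> (g \<beta>)) + (\<sigma> \<beta> - \<sigma> (g \<beta>)) = (\<beta> + g \<beta>) + (\<beta> - g \<beta>)"
        unfolding Gal_hom(1,6)[OF \<sigma>G] by (simp only:)
      then have "2 * \<sigma> \<beta> = 2 * \<beta>" by (simp add: algebra_simps)
      then show "\<sigma> \<beta> = \<beta>" using two_neq_0 by simp
    qed
  qed
  \<comment> \<open>Representatives for the orbit of \<open>x\<close>, that is, for the cosets of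
    its stabiliser.\<close>
  obtain R where R: "R \<subseteq> carrier (Gal F)" "finite R" "(\<lambda>g. g x) ` carrier (Gal F) = (\<lambda>g. g x) ` R"
    using finite_subset_image[OF finite_Gal_orbit[of x] order_refl] by blast
  obtain gs where gs: "set gs = R" using finite_list[OF R(2)] by blast
  show ?thesis
  proof (rule split[of gs])
    show "set gs \<subseteq> carrier (Gal F)" using R(1) gs by simp
    show "P x" unfolding P_def using x by blast
    fix \<beta> assume \<beta>: "P \<beta>" and eig: "\<forall>g\<in>set gs. g \<beta> = \<beta> \<or> g \<beta> = - \<beta>"
    \<comment> \<open>A simultaneous eigenvector with eigenvalues 1 and -1 has its square fixed by
      the whole group, hence in \<open>F\<close>.\<close>
    have "g (\<beta> * \<beta>) = \<beta> * \<beta>" if g: "g \<in> carrier (Gal F)" for g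
    proof -
      obtain r where r: "r \<in> R" "g x = r x" using R(3) g by blast
      have rG: "r \<in> carrier (Gal F)" using r R(1) by blast
      let ?t = "inv\<^bsub>Gal F\<^esub> r \<circ> g"
      have "?t \<in> carrier (Gal F)" "?t x = x"
        using Gal_comp[OF Gal_inv(1)[OF rG] g] r(2) Gal_inv(2)[OF rG] by auto
      then have "?t \<beta> = \<beta>" using \<beta> unfolding P_def by blast
      then have "g \<beta> = r \<beta>" using Gal_inv(3)[OF rG] by (metis comp_apply)
      then have "g \<beta> = \<beta> \<or> g \<beta> = - \<beta>" using eig r(1) gs by simp
      then show ?thesis using Gal_hom(2)[OF g] by auto
    qed
    then have "\<beta> * \<beta> \<in> F" by (rule fixed_by_Gal_imp_mem)
    then show "\<sigma> \<beta> = \<beta>" using \<sigma> unfolding sqrt_fixer_def by blast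
  qed
qed

definition squares :: "('a \<Rightarrow> 'a) set" where
  "squares = {g \<circ> g | g. g \<in> carrier (Gal F)}"

lemma squares_subset: "squares \<subseteq> carrier (Gal F)"
  unfolding squares_def using Gal_comp by blast

text \<open>The squares have fixed field \<open>square_fixed\<close>, on which
  \<open>sqrt_fixer\<close> is trivial, so the correspondence puts \<open>sqrt_fixer\<close> into
  their closure. Products of squares are open to induction; their limits are reached only through
  this approximation.\<close>

lemma sqrt_fixer_approx:
  assumes "\<sigma> \<in> sqrt_fixer" "finite D"
  obtains s where "s \<in> generate (Gal F) squares" "\<And>x. x \<in> D \<Longrightarrow> s x = \<sigma> x"
proof -
  have "\<sigma> x = x" if "\<forall>s\<in>squares. s x = x" for x
  proof (rule sqrt_fixer_fixes_square_fixed[OF assms(1)])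
    show "x \<in> square_fixed" using that unfolding square_fixed_def squares_def by fastforce
  qed
  then have "\<sigma> \<in> krull_closure F (generate (Gal F) squares)"
    unfolding krull_closure_generate[OF squares_subset]
    using assms(1) unfolding sqrt_fixer_def by blast
  then show ?thesis using assms(2) that unfolding krull_closure_def by blast
qed

section \<open>The field fixed by the W-kernel\<close>

definition W_field :: "'a set" where
  "W_field = {x. (\<forall>g\<in>carrier (Gal F). g (g (g (g x))) = x) \<and>
     (\<forall>g\<in>carrier (Gal F). \<forall>h\<in>carrier (Gal F). g (g (h x)) = h (g (g x)))}"

lemma Gal_pow:
  "\<sigma> [^]\<^bsub>Gal F\<^esub> (2::nat) = \<sigma> \<circ> \<sigma>" "\<sigma> [^]\<^bsub>Gal F\<^esub> (4::nat) = \<sigma> \<circ> \<sigma> \<circ> \<sigma> \<circ> \<sigma>"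
  by (simp_all add: numeral_eq_Suc)

lemma commutator_fixes_iff:
  assumes "\<sigma> \<in> carrier (Gal F)" "\<tau> \<in> carrier (Gal F)"
  shows "commutator (Gal F) \<sigma> \<tau> x = x \<longleftrightarrow> \<sigma> (\<tau> x) = \<tau> (\<sigma> x)"
  unfolding commutator_def using Gal_inv[OF assms(1)] Gal_inv[OF assms(2)]
  by (metis Gal_mult comp_apply)

text \<open>\<open>W_field\<close> collects the common fixed points of the defining generators. From
  here on the kernel is handled through this field, without reference to closures.\<close>

lemma W_kernel_eq: "W_kernel F = {\<sigma> \<in> carrier (Gal F). \<forall>x\<in>W_field. \<sigma> x = x}"
proof -
  let ?G = "carrier (Gal F)"
  let ?S = "{x [^]\<^bsub>Gal F\<^esub> (4::nat) | x. x \<in> ?G} \<union>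
      {commutator (Gal F) (x [^]\<^bsub>Gal F\<^esub> (2::nat)) y | x y. x \<in> ?G \<and> y \<in> ?G}"
  have S: "?S \<subseteq> ?G"
    unfolding commutator_def Gal_pow by (auto intro!: Gal_comp Gal_inv(1))
  have "(\<forall>s\<in>?S. s x = x) \<longleftrightarrow> x \<in> W_field" for x
  proof -
    have "(\<forall>s\<in>?S. s x = x) \<longleftrightarrow> (\<forall>g\<in>?G. (g \<circ> g \<circ> g \<circ> g) x = x) \<and>
        (\<forall>g\<in>?G. \<forall>h\<in>?G. commutator (Gal F) (g \<circ> g) h x = x)"
      unfolding Gal_pow by blast
    also have "\<dots> \<longleftrightarrow> x \<in> W_field"
      unfolding W_field_def using commutator_fixes_iff Gal_comp by simp
    finally show ?thesis .
  qed
  then show ?thesis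
    unfolding W_kernel_def krull_closure_generate[OF S] by auto
qed

lemma W_fieldI:
  assumes "\<And>g. g \<in> carrier (Gal F) \<Longrightarrow> g (g (g (g x))) = x"
    "\<And>g h. g \<in> carrier (Gal F) \<Longrightarrow> h \<in> carrier (Gal F) \<Longrightarrow> g (g (h x)) = h (g (g x))"
  shows "x \<in> W_field"
  using assms unfolding W_field_def by blast

lemma W_fieldD:
  assumes "x \<in> W_field" "g \<in> carrier (Gal F)"
  shows "g (g (g (g x))) = x" "h \<in> carrier (Gal F) \<Longrightarrow> g (g (h x)) = h (g (g x))"
  using assms unfolding W_field_def by blast+

lemma W_field_stable:
  assumes "x \<in> W_field" "k \<in> carrier (Gal F)"
  shows "k x \<in> W_field"
  unfolding W_field_def
proof (intro CollectI conjI ballI)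
  fix g assume g: "g \<in> carrier (Gal F)"
  \<comment> \<open>The hypothesis speaks only about \<open>x\<close>, so the second square is moved
    past \<open>k\<close> by using \<open>k \<circ> (g \<circ> g)\<close> as the commuting
    automorphism.\<close>
  show "g (g (g (g (k x)))) = k x"
    using W_fieldD(2)[OF assms(1) g assms(2)] W_fieldD(1)[OF assms(1) g]
      W_fieldD(2)[OF assms(1) g Gal_comp[OF assms(2) Gal_comp[OF g g]]] by simp
  fix h assume h: "h \<in> carrier (Gal F)"
  show "g (g (h (k x))) = h (g (g (k x)))"
    using W_fieldD(2)[OF assms(1) g Gal_comp[OF h assms(2)]] W_fieldD(2)[OF assms(1) g assms(2)] by simp
qed

lemma squares_on_W_field:
  assumes "s \<in> squares" "x \<in> W_field"
  shows "s (s x) = x" "h \<in> carrier (Gal F) \<Longrightarrow> s (h x) = h (s x)"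
proof -
  obtain g where g: "g \<in> carrier (Gal F)" "s = g \<circ> g" using assms(1) unfolding squares_def by blast
  show "s (s x) = x" unfolding g(2) using W_fieldD(1)[OF assms(2) g(1)] by (simp only: comp_apply)
  show "s (h x) = h (s x)" if "h \<in> carrier (Gal F)"
    unfolding g(2) using W_fieldD(2)[OF assms(2) g(1) that] by (simp only: comp_apply)
qed

text \<open>Centrality has to be carried along, since a product of involutions is again one only if
  they commute. The point is arbitrary because \<open>t x\<close> occurs in the product
  case.\<close>

lemma generate_squares_on_W_field:
  assumes "s \<in> generate (Gal F) squares" "x \<in> W_field"
  shows "s (s x) = x \<and> (\<forall>h\<in>carrier (Gal F). s (h x) = h (s x))"
  using assms
proof (induction arbitrary: x)
  case one
  then show ?case by simp
next
  case (incl s)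
  then show ?case using squares_on_W_field by blast
next
  case (inv s)
  have s: "s \<in> carrier (Gal F)" using inv.hyps squares_subset by blast
  have eq: "(inv\<^bsub>Gal F\<^esub> s) x = s x" if "x \<in> W_field" for x
    using squares_on_W_field(1)[OF inv.hyps that] Gal_inv(2)[OF s] by metis
  show ?case
  proof (intro conjI ballI)
    show "(inv\<^bsub>Gal F\<^esub> s) ((inv\<^bsub>Gal F\<^esub> s) x) = x"
      unfolding eq[OF inv.prems] by (rule Gal_inv(2)[OF s])
    fix h assume h: "h \<in> carrier (Gal F)"
    show "(inv\<^bsub>Gal F\<^esub> s) (h x) = h ((inv\<^bsub>Gal F\<^esub> s) x)"
      unfolding eq[OF inv.prems] eq[OF W_field_stable[OF inv.prems h]]
      by (rule squares_on_W_field(2)[OF inv.hyps inv.prems h])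
  qed
next
  case (eng s t)
  have t: "t \<in> carrier (Gal F)"
    using eng.hyps(2) group.generate_incl[OF group_Gal squares_subset] by blast
  have tx: "t x \<in> W_field" by (rule W_field_stable[OF eng.prems t])
  have s1: "s (s z) = z" "\<And>h. h \<in> carrier (Gal F) \<Longrightarrow> s (h z) = h (s z)" if "z \<in> W_field" for z
    using eng.IH(1)[OF that] by auto
  have t1: "t (t x) = x" "\<And>h. h \<in> carrier (Gal F) \<Longrightarrow> t (h x) = h (t x)"
    using eng.IH(2)[OF eng.prems] by auto
  have "s (t (s (t x))) = x"
    using s1(2)[OF tx t] t1(1) s1(1)[OF eng.prems] by metis
  moreover have "s (t (h x)) = h (s (t x))" if h: "h \<in> carrier (Gal F)" for h
    using t1(2)[OF h] s1(2)[OF tx h] by simp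
  ultimately show ?case by simp
qed

lemma sqrt_fixer_on_W_field:
  assumes \<sigma>: "\<sigma> \<in> sqrt_fixer" and x: "x \<in> W_field"
  shows "\<sigma> (\<sigma> x) = x" "h \<in> carrier (Gal F) \<Longrightarrow> \<sigma> (h x) = h (\<sigma> x)"
proof -
  \<comment> \<open>These are all the points at which the two equations evaluate \<sigma>.\<close>
  obtain s where s: "s \<in> generate (Gal F) squares" "\<And>z. z \<in> {x, \<sigma> x, h x} \<Longrightarrow> s z = \<sigma> z"
    using sqrt_fixer_approx[OF \<sigma>, of "{x, \<sigma> x, h x}"] by blast
  have eq: "s x = \<sigma> x" "s (\<sigma> x) = \<sigma> (\<sigma> x)" "s (h x) = \<sigma> (h x)" using s(2) by auto
  note Z = generate_squares_on_W_field[OF s(1) x]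
  have "s (s x) = x" using Z by blast
  then show "\<sigma> (\<sigma> x) = x" using eq by simp
  assume "h \<in> carrier (Gal F)"
  then have "s (h x) = h (s x)" using Z by blast
  then show "\<sigma> (h x) = h (\<sigma> x)" using eq by simp
qed

end

section \<open>Elementary abelian subgroups and a central subgroup\<close>

text \<open>Used with an elementary abelian \<open>H\<close> for the index, and with a maximal open
  subgroup for the Frattini subgroup, where the last part computes squares.\<close>

lemma (in group) central_set_mult:
  assumes P: "subgroup P G" "\<And>a b. a \<in> P \<Longrightarrow> b \<in> carrier G \<Longrightarrow> a \<otimes> b = b \<otimes> a"
    and H: "subgroup H G"
  shows "subgroup (P <#> H) G" "P \<subseteq> P <#> H" "H \<subseteq> P <#> H"
    "x \<in> P \<Longrightarrow> h \<in> H \<Longrightarrow> y \<in> P \<Longrightarrow> k \<in> H \<Longrightarrow> (x \<otimes> h) \<otimes> (y \<otimes> k) = (x \<otimes> y) \<otimes> (h \<otimes> k)"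
proof -
  note car = subgroup.mem_carrier[OF P(1)] subgroup.mem_carrier[OF H]
  have "P \<lhd> G"
    unfolding normal_inv_iff using P car
    by (auto simp: m_assoc[symmetric]) (metis inv_solve_right m_closed)
  then show "subgroup (P <#> H) G" using H by (rule mult_norm_subgroup)
  show "P \<subseteq> P <#> H"
  proof
    fix p assume p: "p \<in> P"
    then have "p = p \<otimes> \<one>" using car by simp
    then show "p \<in> P <#> H" unfolding set_mult_def using p subgroup.one_closed[OF H] by blast
  qed
  show "H \<subseteq> P <#> H"
  proof
    fix h assume h: "h \<in> H"
    then have "h = \<one> \<otimes> h" using car by simp
    then show "h \<in> P <#> H" unfolding set_mult_def using h subgroup.one_closed[OF P(1)] by blast
  qed
  show "(x \<otimes> h) \<otimes> (y \<otimes> k) = (x \<otimes> y) \<otimes> (h \<otimes> k)"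
    if "x \<in> P" "h \<in> H" "y \<in> P" "k \<in> H"
    using that car P(2)[of y h] by (metis m_assoc m_closed)
qed

lemma (in group) elem_abelian_central_set_mult:
  assumes P: "elem_abelian_2_subgroup P G" "\<And>a b. a \<in> P \<Longrightarrow> b \<in> carrier G \<Longrightarrow> a \<otimes> b = b \<otimes> a"
    and H: "elem_abelian_2_subgroup H G"
  shows "elem_abelian_2_subgroup (P <#> H) G" "P \<subseteq> P <#> H" "H \<subseteq> P <#> H"
proof -
  have sub: "subgroup P G" "subgroup H G"
    using P(1) H unfolding elem_abelian_2_subgroup_def by auto
  note central = central_set_mult[OF sub(1) P(2) sub(2)]
  have "x \<otimes> x = \<one> \<and> x \<otimes> y = y \<otimes> x" if xy: "x \<in> P <#> H" "y \<in> P <#> H" for x y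
  proof -
    obtain p h q k where *: "p \<in> P" "h \<in> H" "q \<in> P" "k \<in> H" "x = p \<otimes> h" "y = q \<otimes> k"
      using xy unfolding set_mult_def by blast
    have "p \<otimes> p = \<one>" "h \<otimes> h = \<one>" "p \<otimes> q = q \<otimes> p" "h \<otimes> k = k \<otimes> h"
      using P(1) H *(1-4) unfolding elem_abelian_2_subgroup_def by simp_all
    moreover have "x \<otimes> x = (p \<otimes> p) \<otimes> (h \<otimes> h)" "x \<otimes> y = (p \<otimes> q) \<otimes> (h \<otimes> k)"
      "y \<otimes> x = (q \<otimes> p) \<otimes> (k \<otimes> h)"
      unfolding *(5,6) using central(4) *(1-4) by blast+
    ultimately show ?thesis by simp
  qed
  then show "elem_abelian_2_subgroup (P <#> H) G"
    unfolding elem_abelian_2_subgroup_def using central(1) by blast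
  show "P \<subseteq> P <#> H" "H \<subseteq> P <#> H" using central(2,3) by simp_all
qed

lemma (in group) elem_abelian_involution:
  assumes "c \<in> carrier G" "c \<otimes> c = \<one>"
  shows "elem_abelian_2_subgroup {\<one>, c} G"
proof -
  have "inv c = c" using assms by (simp add: inv_equality)
  then have "subgroup {\<one>, c} G" using assms by (intro subgroupI) auto
  then show ?thesis using assms unfolding elem_abelian_2_subgroup_def by auto
qed

text \<open>Maximality makes \<open>A\<close> absorb the central group \<open>P\<close>. It also
  rules out \<open>A\<close> = \<open>P\<close>, since \<open>c\<close> could be added to
  \<open>P\<close>. Finally, any two elements of \<open>A\<close> outside \<open>P\<close> have
  their product in \<open>P\<close>, so they share a coset, being their own inverses.\<close>

lemma (in group) maximal_elem_abelian_index_two: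
  assumes P: "elem_abelian_2_subgroup P G" "\<And>a b. a \<in> P \<Longrightarrow> b \<in> carrier G \<Longrightarrow> a \<otimes> b = b \<otimes> a"
    and c: "c \<in> carrier G" "c \<otimes> c = \<one>" "c \<notin> P"
    and prod: "\<And>s t. \<lbrakk>s \<in> carrier G; t \<in> carrier G; s \<otimes> s = \<one>; t \<otimes> t = \<one>; s \<otimes> t = t \<otimes> s;
      s \<notin> P; t \<notin> P\<rbrakk> \<Longrightarrow> s \<otimes> t \<in> P"
    and A: "maximal_elem_abelian_subgroup A G"
  shows "P \<subseteq> A" "card (rcosets\<^bsub>G\<lparr>carrier := A\<rparr>\<^esub> P) = 2"
proof -
  have A1: "elem_abelian_2_subgroup A G" and max: "\<And>B. elem_abelian_2_subgroup B G \<Longrightarrow> A \<subseteq> B \<Longrightarrow> B = A"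
    using A unfolding maximal_elem_abelian_subgroup_def by auto
  show "P \<subseteq> A"
    using elem_abelian_central_set_mult[OF P A1] max by blast
  have "A \<noteq> P"
  proof
    assume "A = P"
    then have "P <#> {\<one>, c} = P"
      using elem_abelian_central_set_mult(1,2)[OF P elem_abelian_involution[OF c(1,2)]] max by blast
    then show False
      using elem_abelian_central_set_mult(3)[OF P elem_abelian_involution[OF c(1,2)]] c(3) by blast
  qed
  then obtain t where t: "t \<in> A" "t \<notin> P" using \<open>P \<subseteq> A\<close> by blast
  have sub: "subgroup P G" "subgroup A G"
    using P(1) A1 unfolding elem_abelian_2_subgroup_def by auto
  have sq: "a \<otimes> a = \<one>" "a \<in> carrier G" "b \<in> A \<Longrightarrow> a \<otimes> b = b \<otimes> a" if "a \<in> A" for a b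
    using that A1 subgroup.mem_carrier[OF sub(2)] unfolding elem_abelian_2_subgroup_def by blast+
  have coset: "P #> a = (if a \<in> P then P else P #> t)" if a: "a \<in> A" for a
  proof (cases "a \<in> P")
    case True
    then show ?thesis using coset_join2[OF sq(2)[OF a] sub(1)] by simp
  next
    case False
    have "a \<otimes> t \<in> P" using prod sq a t False by blast
    moreover have "a = (a \<otimes> t) \<otimes> t" using sq(1,2) a t(1) by (simp add: m_assoc)
    ultimately have "a \<in> P #> t" unfolding r_coset_def by blast
    then have "P #> t = P #> a" by (rule repr_independence[OF _ sq(2)[OF t(1)] sub(1)])
    then show ?thesis using False by simp
  qed
  have "rcosets\<^bsub>G\<lparr>carrier := A\<rparr>\<^esub> P = (\<lambda>a. P #> a) ` A"
    unfolding RCOSETS_def r_coset_def by auto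
  also have "\<dots> = {P, P #> t}"
  proof
    show "(\<lambda>a. P #> a) ` A \<subseteq> {P, P #> t}" using coset by auto
    have "P #> \<one> = P" "\<one> \<in> A" using subgroup.one_closed[OF sub(1)] subgroup.one_closed[OF sub(2)] coset by auto
    then show "{P, P #> t} \<subseteq> (\<lambda>a. P #> a) ` A" using t(1) by (auto simp: image_iff)
  qed
  finally have "rcosets\<^bsub>G\<lparr>carrier := A\<rparr>\<^esub> P = {P, P #> t}" .
  moreover have "P \<noteq> P #> t" using rcos_self[OF sq(2)[OF t(1)] sub(1)] t(2) by blast
  ultimately show "card (rcosets\<^bsub>G\<lparr>carrier := A\<rparr>\<^esub> P) = 2" by simp
qed

section \<open>Complex conjugation\<close>

definition sums_of_squares :: "'a::field set \<Rightarrow> 'a set" where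
  "sums_of_squares K = {sum_list (map (\<lambda>x. x * x) xs) | xs. set xs \<subseteq> K}"

lemma formally_real_iff: "formally_real K \<longleftrightarrow> - 1 \<notin> sums_of_squares K"
  unfolding formally_real_def sums_of_squares_def by (auto simp: eq_commute)

lemma sums_of_squares_induct [consumes 1, case_names zero add]:
  assumes "s \<in> sums_of_squares K" "P 0"
    "\<And>x s. x \<in> K \<Longrightarrow> s \<in> sums_of_squares K \<Longrightarrow> P s \<Longrightarrow> P (x * x + s)"
  shows "P s"
proof -
  have "P (sum_list (map (\<lambda>x. x * x) xs))" if "set xs \<subseteq> K" for xs
    using that
  proof (induction xs)
    case (Cons x xs)
    moreover have "sum_list (map (\<lambda>x. x * x) xs) \<in> sums_of_squares K"
      using Cons.prems unfolding sums_of_squares_def by auto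
    ultimately show ?case using assms(3) by simp
  qed (simp add: assms(2))
  then show ?thesis using assms(1) unfolding sums_of_squares_def by blast
qed

lemma sums_of_squares_square: "x \<in> K \<Longrightarrow> x * x \<in> sums_of_squares K"
  unfolding sums_of_squares_def by (intro CollectI exI[of _ "[x]"]) simp

lemma sums_of_squares_add:
  assumes "s \<in> sums_of_squares K" "t \<in> sums_of_squares K"
  shows "s + t \<in> sums_of_squares K"
proof -
  obtain xs ys where "set xs \<subseteq> K" "s = sum_list (map (\<lambda>x. x * x) xs)"
    "set ys \<subseteq> K" "t = sum_list (map (\<lambda>x. x * x) ys)"
    using assms unfolding sums_of_squares_def by blast
  then show ?thesis
    unfolding sums_of_squares_def by (intro CollectI exI[of _ "xs @ ys"]) simp
qed

context
  fixes K :: "'a::field set"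
  assumes K: "subfield_of K"
begin

lemma sums_of_squares_zero: "0 \<in> sums_of_squares K"
  using sums_of_squares_square[OF subfield_of_closed(1)[OF K]] by simp

lemma sums_of_squares_subset: "s \<in> sums_of_squares K \<Longrightarrow> s \<in> K"
  by (induction rule: sums_of_squares_induct) (simp_all add: subfield_of_closed[OF K])

lemma sums_of_squares_scale:
  assumes "s \<in> sums_of_squares K" "y \<in> K"
  shows "y * y * s \<in> sums_of_squares K"
  using assms(1)
proof (induction rule: sums_of_squares_induct)
  case zero
  then show ?case using sums_of_squares_zero by simp
next
  case (add x s)
  have "(y * x) * (y * x) + y * y * s \<in> sums_of_squares K"
    using sums_of_squares_add[OF sums_of_squares_square add.IH] subfield_of_closed(6)[OF K assms(2) add.hyps(1)]
    by blast
  then show ?case by (simp add: algebra_simps)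
qed

lemma sums_of_squares_mult:
  assumes "s \<in> sums_of_squares K" "t \<in> sums_of_squares K"
  shows "s * t \<in> sums_of_squares K"
  using assms(1)
proof (induction rule: sums_of_squares_induct)
  case zero
  then show ?case using sums_of_squares_zero by simp
next
  case (add x s)
  have "x * x * t + s * t \<in> sums_of_squares K"
    by (rule sums_of_squares_add[OF sums_of_squares_scale[OF assms(2) add.hyps(1)] add.IH])
  then show ?case by (simp add: algebra_simps)
qed

lemma sums_of_squares_inverse:
  assumes "s \<in> sums_of_squares K"
  shows "inverse s \<in> sums_of_squares K"
proof (cases "s = 0")
  case False
  then have "inverse s = inverse s * inverse s * s" by simp
  then show ?thesis
    using sums_of_squares_scale[OF assms subfield_of_closed(7)[OF K sums_of_squares_subset[OF assms]]]
    by (simp only:)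
qed (simp add: sums_of_squares_zero)

end

section \<open>A maximal formally real subfield and its conjugation\<close>

lemma formally_real_Union_chain:
  assumes "\<C> \<noteq> {}" "subset.chain \<A> \<C>" "\<And>K. K \<in> \<C> \<Longrightarrow> formally_real K"
  shows "formally_real (\<Union>\<C>)"
  unfolding formally_real_def
proof
  assume "\<exists>xs. set xs \<subseteq> \<Union>\<C> \<and> sum_list (map (\<lambda>x. x * x) xs) = - 1"
  then obtain xs where xs: "set xs \<subseteq> \<Union>\<C>" "sum_list (map (\<lambda>x. x * x) xs) = - 1" by blast
  obtain K where "K \<in> \<C>" "set xs \<subseteq> K"
    by (rule finite_subset_Union_chain[OF finite_set xs(1) assms(1,2)])
  then show False using assms(3) xs(2) unfolding formally_real_def by blast
qed

text \<open>Artin-Schreier theory inside the quadratic closure. A maximal formally real intermediate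
  field R is Euclidean: each d in R is a square up to sign, and sums of squares are squares. Hence
  R(i) is closed under square roots and equals the whole field, so the automorphism over R sending i
  to -i is an involution.\<close>

lemma (in quadratic_closure) ex_involution:
  assumes real: "formally_real F"
  obtains c where "c \<in> carrier (Gal F)" "c \<circ> c = id" "\<And>i. i * i = - 1 \<Longrightarrow> c i = - i"
proof -
  let ?P = "\<lambda>K. subfield_of K \<and> F \<subseteq> K \<and> formally_real K"
  obtain R where P: "?P R" "F \<subseteq> R" and max: "\<And>K. ?P K \<Longrightarrow> R \<subseteq> K \<Longrightarrow> K = R"
  proof (rule maximal_superset[where P = ?P and S = F])
    show "?P F" using subfield real by blast
    fix \<C> assume C: "\<C> \<noteq> {}" "subset.chain {K. ?P K} \<C>" and all: "\<And>K. K \<in> \<C> \<Longrightarrow> ?P K"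
    have "subfield_of (\<Union>\<C>)"
      by (rule subfield_of_Union_chain[OF C]) (use all in auto)
    moreover have "formally_real (\<Union>\<C>)"
      by (rule formally_real_Union_chain[OF C]) (use all in auto)
    ultimately show "?P (\<Union>\<C>)" using C(1) all by blast
  qed (rule that)
  have R: "subfield_of R" and realR: "- 1 \<notin> sums_of_squares R"
    using P(1) formally_real_iff by auto
  note RC = subfield_of_closed[OF R]
  note S = sums_of_squares_square sums_of_squares_add sums_of_squares_mult[OF R] sums_of_squares_inverse[OF R]
  \<comment> \<open>If d has no root in R, adjoining one destroys formal reality by maximality.
    Solving the resulting expression of -1 for -d exhibits it as (1 + A) / B with sums of squares A
    and B.\<close>
  have minus_sos: "- d \<in> sums_of_squares R" if d: "d \<in> R" "\<And>z. z \<in> R \<Longrightarrow> z * z \<noteq> d" for d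
  proof -
    obtain y where y: "y * y = d" using ex_sqrt by blast
    have yR: "y \<notin> R" using d(2) y by blast
    let ?K = "{a + b * y | a b. a \<in> R \<and> b \<in> R}"
    have "subfield_of ?K" by (rule subfield_of_adjoin[OF R P(2)]) (use y d in simp)
    moreover note sub = subset_adjoin_field[OF R, of y]
    ultimately have "\<not> formally_real ?K"
      using max[of ?K] P(2) yR by (metis (no_types, lifting) subset_trans)
    then have "- 1 \<in> sums_of_squares ?K" using formally_real_iff by blast
    \<comment> \<open>\<open>A\<close> and \<open>B\<close> collect the squares of the two
      coordinates, \<open>C\<close> the cross terms. In the expression of -1 the coefficient
      \<open>C\<close> must vanish, as \<open>y\<close> is not in \<open>R\<close>.\<close>
    moreover have "\<exists>A\<in>sums_of_squares R. \<exists>B\<in>sums_of_squares R. \<exists>C\<in>R. s = A + d * B + C * y"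
      if "s \<in> sums_of_squares ?K" for s
      using that
    proof (induction rule: sums_of_squares_induct)
      case zero
      have "0 = 0 + d * 0 + 0 * y" by simp
      then show ?case using sums_of_squares_zero[OF R] RC(1) by blast
    next
      case (add x s)
      obtain a b where ab: "x = a + b * y" "a \<in> R" "b \<in> R" using add.hyps(1) by blast
      obtain A B C where ABC: "A \<in> sums_of_squares R" "B \<in> sums_of_squares R" "C \<in> R"
        "s = A + d * B + C * y" using add.IH by blast
      have "x * x + s = (a * a + A) + d * (b * b + B) + (a * b + a * b + C) * y"
        unfolding ab ABC y[symmetric] by (simp add: algebra_simps)
      moreover have "a * a + A \<in> sums_of_squares R" "b * b + B \<in> sums_of_squares R"
        using S(1,2) ab ABC by blast+
      moreover have "a * b + a * b + C \<in> R" by (intro RC(3) RC(6) ab ABC)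
      ultimately show ?case by blast
    qed
    ultimately obtain A B C where ABC: "A \<in> sums_of_squares R" "B \<in> sums_of_squares R" "C \<in> R"
      "- 1 = A + d * B + C * y" by blast
    have AB: "A \<in> R" "B \<in> R" using ABC sums_of_squares_subset[OF R] by auto
    have "C = 0"
    proof (rule ccontr)
      assume "C \<noteq> 0"
      moreover have "C * y = - 1 - A - d * B" unfolding ABC(4) by simp
      ultimately have "y = (- 1 - A - d * B) / C" by (simp add: field_simps)
      then show False using yR AB ABC(3) d(1) RC by simp
    qed
    with ABC(4) have eq: "- 1 = A + d * B" by simp
    then have B: "B \<noteq> 0" using ABC(1) realR by auto
    have "- d * B = 1 + A" using eq by (simp add: algebra_simps) (metis add.commute add_uminus_conv_diff diff_eq_eq minus_add_distrib minus_minus)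
    then have "- d = (1 * 1 + A) * inverse B" using B by (simp add: field_simps)
    then show ?thesis using S(3)[OF S(2)[OF S(1)[OF RC(2)] ABC(1)] S(4)[OF ABC(2)]] by simp
  qed
  \<comment> \<open>Otherwise both d and -d would be sums of squares, and so would their quotient
    -1.\<close>
  have sos_sqrt: "\<exists>z\<in>R. z * z = d" if d: "d \<in> sums_of_squares R" for d
  proof (rule ccontr)
    assume n: "\<not> (\<exists>z\<in>R. z * z = d)"
    then have "d \<noteq> 0" using RC(1) by auto
    have "- d \<in> sums_of_squares R" using minus_sos sums_of_squares_subset[OF R d] n by blast
    from S(3)[OF this S(4)[OF d]] have "- 1 \<in> sums_of_squares R" using \<open>d \<noteq> 0\<close> by simp
    then show False using realR by simp
  qed
  have pm_sqrt: "\<exists>z\<in>R. z * z = d \<or> z * z = - d" if "d \<in> R" for d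
    using minus_sos[OF that] sos_sqrt by blast
  obtain i where i: "i * i = (- 1 :: 'a)" using ex_sqrt by blast
  have iR: "i \<notin> R" using S(1) i realR by metis
  let ?L = "{a + b * i | a b. a \<in> R \<and> b \<in> R}"
  have "?L = UNIV"
  proof (rule sqrt_closed_imp_UNIV)
    show L: "subfield_of ?L" by (rule subfield_of_adjoin[OF R P(2)]) (use i RC in simp)
    show "F \<subseteq> ?L" using P(2) subset_adjoin_field(1)[OF R] by blast
    fix y assume "y * y \<in> ?L"
    then obtain a b where ab: "y * y = a + b * i" "a \<in> R" "b \<in> R" by blast
    have "\<exists>w\<in>?L. w * w = a + b * i"
    proof (cases "b = 0")
      case True
      obtain z where z: "z \<in> R" "z * z = a \<or> z * z = - a" using pm_sqrt[OF ab(2)] by blast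
      have zL: "z \<in> ?L" "z * i \<in> ?L"
        using z subset_adjoin_field[OF R] subfield_of_closed(6)[OF L] by blast+
      have "(z * i) * (z * i) = z * z * (i * i)" by (simp add: algebra_simps)
      then have "(z * i) * (z * i) = - (z * z)" unfolding i by simp
      then show ?thesis
        using z(2) True bexI[OF _ zL(1), of "\<lambda>w. w * w = a"] bexI[OF _ zL(2), of "\<lambda>w. w * w = a"]
        by (metis (no_types, lifting) add.right_neutral minus_minus mult_zero_left)
    next
      case False
      obtain c where c: "c \<in> R" "c * c = a * a + b * b"
        using sos_sqrt[OF S(2)[OF S(1)[OF ab(2)] S(1)[OF ab(3)]]] by blast
      \<comment> \<open>For (u + v i)^2 = a + b i one needs u^2 - v^2 = a and 2 u v = b, so u^2 and
        -v^2 have sum a and product -b^2/4. These are the roots of that quadratic, whose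
        discriminant is c^2.\<close>
      define e f where "e = (a + c) / 2" and "f = (a - c) / 2"
      have twoR: "2 \<in> R" using RC(3)[OF RC(2) RC(2)] by simp
      have efR: "e \<in> R" "f \<in> R" unfolding e_def f_def using ab c RC twoR by simp_all
      have sum: "e + f = a" unfolding e_def f_def using two_neq_0 by (simp add: field_simps)
      have "4 * (e * f) = a * a - c * c"
      proof -
        have "2 * e = a + c" "2 * f = a - c" unfolding e_def f_def using two_neq_0 by simp_all
        then have "(2 * e) * (2 * f) = (a + c) * (a - c)" by simp
        then show ?thesis by (simp add: algebra_simps)
      qed
      then have ef: "4 * (e * f) = - (b * b)" using c(2) by simp
      \<comment> \<open>No ordering is available to pick the nonnegative root. If neither were a
        square, -e and -f would be, and 4 e f = -b^2 would turn -1 into a square.\<close>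
      have "\<exists>u\<in>R. u * u = e \<or> u * u = f"
      proof (rule ccontr)
        assume n: "\<not> (\<exists>u\<in>R. u * u = e \<or> u * u = f)"
        then obtain u v where uv: "u \<in> R" "v \<in> R" "u * u = - e" "v * v = - f"
          using pm_sqrt efR by metis
        let ?w = "2 * u * v / b"
        have "?w * ?w = 4 * ((u * u) * (v * v)) / (b * b)" by (simp add: field_simps)
        also have "\<dots> = - 1" unfolding uv using ef False by simp
        finally have "?w * ?w = - 1" .
        moreover have "?w \<in> R" using uv twoR ab RC by simp
        ultimately show False using S(1) realR by metis
      qed
      \<comment> \<open>\<open>g\<close> is the other root of the quadratic; it will be minus the
        square of \<open>b / (2 * u)\<close>.\<close>
      then obtain u g where u: "u \<in> R" and g: "4 * (u * u * g) = - (b * b)" "u * u + g = a"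
        using ef sum by (metis add.commute mult.commute)
      have "u \<noteq> 0" using g(1) False by auto
      let ?v = "b / (2 * u)"
      have v: "2 * (u * ?v) = b" using \<open>u \<noteq> 0\<close> two_neq_0 by simp
      have "4 * (u * u) * (?v * ?v) = (2 * (u * ?v)) * (2 * (u * ?v))" by (simp add: algebra_simps)
      also have "\<dots> = 4 * (u * u) * (- g)" unfolding v using g(1) by (simp add: algebra_simps)
      finally have "4 * (u * u) * (?v * ?v) = 4 * (u * u) * (- g)" .
      moreover have "4 * (u * u) = (2 * u) * (2 * u)" by (simp add: algebra_simps)
      moreover have "2 * u \<noteq> 0" using two_neq_0 \<open>u \<noteq> 0\<close> by simp
      ultimately have vv: "?v * ?v = - g" by (simp only: mult_cancel_left mult_eq_0_iff) blast
      have "(u + ?v * i) * (u + ?v * i) = u * u + ?v * ?v * (i * i) + 2 * (u * ?v) * i"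
        by (simp only: algebra_simps mult_2)
      also have "\<dots> = a + b * i" unfolding v i vv using g(2) by simp
      finally have "(u + ?v * i) * (u + ?v * i) = a + b * i" .
      moreover have "?v \<in> R" using u twoR ab RC by simp
      ultimately show ?thesis using u by blast
    qed
    then obtain w where w: "w \<in> ?L" "w * w = y * y" using ab(1) by auto
    have "y = w \<or> y = - w" using square_eq_cases[of y w] w(2) by simp
    then show "y \<in> ?L" using w(1) subfield_of_closed(5)[OF L] by blast
  qed
  obtain c where c: "c \<in> carrier (Gal F)" "\<And>a. a \<in> R \<Longrightarrow> c a = a" "c i = - i"
    by (rule adjoin_conjugation[OF R P(2) iR]) (use i RC in auto)
  have "c (c x) = x" for x
  proof -
    have "x \<in> ?L" using \<open>?L = UNIV\<close> by blast
    then obtain a b where "x = a + b * i" "a \<in> R" "b \<in> R" by blast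
    then show ?thesis using c(2,3) Gal_hom[OF c(1)] by simp
  qed
  moreover have "c j = - j" if "j * j = - 1" for j
    using square_eq_cases[of j i] that i c(3) Gal_hom(5)[OF c(1)] by auto
  ultimately show ?thesis by (intro that[OF c(1)]) (simp_all add: fun_eq_iff)
qed

section \<open>The W-group\<close>

context quadratic_closure
begin

section \<open>Square roots and fourth roots in \<open>W_field\<close>\<close>

lemma sqrt_image:
  assumes "y * y \<in> F" "g \<in> carrier (Gal F)"
  shows "g y = y \<or> g y = - y"
  using square_eq_cases[of "g y" y] assms Gal_hom(2)[OF assms(2), of y y] unfolding mem_Gal_iff by simp

lemma sqrt_mem_W_field:
  assumes y: "y * y \<in> F"
  shows "y \<in> W_field"
proof -
  have gg: "g (g y) = y" if g: "g \<in> carrier (Gal F)" for g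
    using sqrt_image[OF y g] Gal_hom(5)[OF g] by auto
  show ?thesis
  proof (rule W_fieldI)
    fix g assume g: "g \<in> carrier (Gal F)"
    show "g (g (g (g y))) = y" by (simp only: gg[OF g])
    fix h assume h: "h \<in> carrier (Gal F)"
    show "g (g (h y)) = h (g (g y))"
      using sqrt_image[OF y h] gg[OF g] Gal_hom(5)[OF g] by auto
  qed
qed

lemma minus_one_mem: "- 1 \<in> F"
  using subfield_of_closed(2,5)[OF subfield] by simp

text \<open>Each automorphism multiplies \<open>d\<close> by a power of i. Its square therefore
  sends \<open>d\<close> to \<open>d\<close> or \<open>- d\<close> and fixes i, which makes it
  central and of order at most two on \<open>d\<close> and its conjugates.\<close>

lemma fourth_root_mem_W_field:
  assumes d: "d * d * (d * d) \<in> F"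
  shows "d \<in> W_field"
proof -
  obtain i where i: "i * i = (- 1 :: 'a)" using ex_sqrt by blast
  have iF: "i * i \<in> F" using i minus_one_mem by simp
  have im: "g d = d \<or> g d = - d \<or> g d = i * d \<or> g d = - (i * d)" if g: "g \<in> carrier (Gal F)" for g
  proof -
    consider "g (d * d) = d * d" | "g (d * d) = - (d * d)" using sqrt_image[OF d g] by blast
    then show ?thesis
    proof cases
      case 1
      then have "g d * g d = d * d" using Gal_hom(2)[OF g] by simp
      then show ?thesis using square_eq_cases by blast
    next
      case 2
      have "(i * d) * (i * d) = (i * i) * (d * d)" by (simp only: ac_simps)
      then have "g d * g d = (i * d) * (i * d)" using 2 i Gal_hom(2)[OF g] by simp
      then show ?thesis using square_eq_cases by blast
    qed
  qed
  have id: "i * (i * d) = - d" using i by (simp flip: mult.assoc)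
  have gg: "g (g d) = d \<or> g (g d) = - d" if g: "g \<in> carrier (Gal F)" for g
  proof -
    have "g i = i \<or> g i = - i" by (rule sqrt_image[OF iF g])
    then show ?thesis
      using im[OF g] by (elim disjE) (simp_all add: Gal_hom(2,5)[OF g] id)
  qed
  have ggi: "g (g i) = i" if g: "g \<in> carrier (Gal F)" for g
    using sqrt_image[OF iF g] Gal_hom(5)[OF g] by auto
  have "g (g (g (g d))) = d" if g: "g \<in> carrier (Gal F)" for g
    using gg[OF g] Gal_hom(5)[OF g] by auto
  moreover have "g (g (h d)) = h (g (g d))" if g: "g \<in> carrier (Gal F)" and h: "h \<in> carrier (Gal F)" for g h
    using im[OF h] gg[OF g]
    by (elim disjE) (simp_all add: Gal_hom(2,5)[OF g] Gal_hom(5)[OF h] ggi[OF g])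
  ultimately show ?thesis by (rule W_fieldI)
qed

text \<open>In the dihedral picture for a fourth root \<open>d\<close>, an automorphism that moves
  \<open>d * d\<close> is a rotation of order four if it fixes i and a reflection if it does not.
  The former is no involution on \<open>W_field\<close>.\<close>

lemma involution_moves_sqrt_minus_one:
  assumes \<sigma>: "\<sigma> \<in> carrier (Gal F)" "\<And>x. x \<in> W_field \<Longrightarrow> \<sigma> (\<sigma> x) = x" "\<sigma> \<notin> sqrt_fixer"
    and i: "i * i = - 1"
  shows "\<sigma> i = - i"
proof (rule ccontr)
  assume "\<sigma> i \<noteq> - i"
  moreover have "i * i \<in> F" using i minus_one_mem by simp
  ultimately have \<sigma>i: "\<sigma> i = i" using sqrt_image[OF _ \<sigma>(1)] by blast
  obtain y where y: "y * y \<in> F" "\<sigma> y \<noteq> y" using \<sigma>(1,3) unfolding sqrt_fixer_def by blast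
  then have \<sigma>y: "\<sigma> y = - y" using sqrt_image[OF _ \<sigma>(1)] by blast
  obtain d where d: "d * d = y" using ex_sqrt by blast
  have "(i * d) * (i * d) = (i * i) * (d * d)" by (simp only: ac_simps)
  then have "\<sigma> d * \<sigma> d = (i * d) * (i * d)"
    using \<sigma>y d i Gal_hom(2)[OF \<sigma>(1), of d d] by simp
  then have im: "\<sigma> d = i * d \<or> \<sigma> d = - (i * d)" by (rule square_eq_cases)
  have "i * (i * d) = - d" using i by (simp flip: mult.assoc)
  then have "\<sigma> (\<sigma> d) = - d"
    using im by (elim disjE) (simp_all add: Gal_hom(2,5)[OF \<sigma>(1)] \<sigma>i)
  moreover have "d \<in> W_field" by (rule fourth_root_mem_W_field) (use d y in simp)
  ultimately have "d = - d" using \<sigma>(2) by metis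
  then have "2 * d = 0" by (metis add.right_inverse mult_2)
  then have "d = 0" using two_neq_0 by simp
  then have "y = 0" using d by simp
  then show False using y(2) Gal_hom(3)[OF \<sigma>(1)] by simp
qed

lemma W_kernel_normal: "W_kernel F \<lhd> Gal F"
proof -
  interpret G: group "Gal F" by (rule group_Gal)
  have "subgroup (W_kernel F) (Gal F)"
  proof (rule G.subgroupI)
    show "W_kernel F \<subseteq> carrier (Gal F)" unfolding W_kernel_eq by blast
    have "id \<in> W_kernel F" unfolding W_kernel_eq using Gal_id by simp
    then show "W_kernel F \<noteq> {}" by blast
    show "inv\<^bsub>Gal F\<^esub> \<sigma> \<in> W_kernel F" if "\<sigma> \<in> W_kernel F" for \<sigma>
    proof -
      have \<sigma>: "\<sigma> \<in> carrier (Gal F)" "\<And>x. x \<in> W_field \<Longrightarrow> \<sigma> x = x"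
        using that unfolding W_kernel_eq by auto
      have "(inv\<^bsub>Gal F\<^esub> \<sigma>) x = x" if "x \<in> W_field" for x
        using Gal_inv(2)[OF \<sigma>(1), of x] \<sigma>(2)[OF that] by simp
      then show ?thesis unfolding W_kernel_eq using Gal_inv(1)[OF \<sigma>(1)] by blast
    qed
    show "\<sigma> \<otimes>\<^bsub>Gal F\<^esub> \<tau> \<in> W_kernel F" if "\<sigma> \<in> W_kernel F" "\<tau> \<in> W_kernel F" for \<sigma> \<tau>
      using that Gal_comp unfolding W_kernel_eq by simp
  qed
  moreover have "\<sigma> \<otimes>\<^bsub>Gal F\<^esub> h \<otimes>\<^bsub>Gal F\<^esub> inv\<^bsub>Gal F\<^esub> \<sigma> \<in> W_kernel F"
    if \<sigma>: "\<sigma> \<in> carrier (Gal F)" and h: "h \<in> W_kernel F" for \<sigma> h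
  proof -
    have h': "h \<in> carrier (Gal F)" "\<And>x. x \<in> W_field \<Longrightarrow> h x = x"
      using h unfolding W_kernel_eq by auto
    have "\<sigma> (h ((inv\<^bsub>Gal F\<^esub> \<sigma>) x)) = x" if "x \<in> W_field" for x
      using h'(2)[OF W_field_stable[OF that Gal_inv(1)[OF \<sigma>]]] Gal_inv(3)[OF \<sigma>] by simp
    then show ?thesis
      unfolding W_kernel_eq using Gal_comp[OF Gal_comp[OF \<sigma> h'(1)] Gal_inv(1)[OF \<sigma>]] by simp
  qed
  ultimately show ?thesis unfolding G.normal_inv_iff by blast
qed

section \<open>The projection onto the W-group\<close>

definition W_proj :: "('a \<Rightarrow> 'a) \<Rightarrow> ('a \<Rightarrow> 'a) set" where
  "W_proj \<sigma> = W_kernel F #>\<^bsub>Gal F\<^esub> \<sigma>"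

lemma group_W: "group (W_group F)"
  unfolding W_group_def by (rule normal.factorgroup_is_group[OF W_kernel_normal])

lemma W_proj_hom: "group_hom (Gal F) (W_group F) W_proj"
  unfolding group_hom_def group_hom_axioms_def W_proj_def W_group_def
  using group_Gal normal.factorgroup_is_group[OF W_kernel_normal] normal.r_coset_hom_Mod[OF W_kernel_normal]
  by blast

lemma carrier_W: "carrier (W_group F) = W_proj ` carrier (Gal F)"
  unfolding W_group_def FactGroup_def RCOSETS_def W_proj_def by auto

lemma W_proj_mult:
  "\<sigma> \<in> carrier (Gal F) \<Longrightarrow> \<tau> \<in> carrier (Gal F) \<Longrightarrow> W_proj \<sigma> \<otimes>\<^bsub>W_group F\<^esub> W_proj \<tau> = W_proj (\<sigma> \<circ> \<tau>)"
  using group_hom.hom_mult[OF W_proj_hom] by simp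

lemma W_proj_one: "W_proj id = \<one>\<^bsub>W_group F\<^esub>"
  using group_hom.hom_one[OF W_proj_hom] by simp

lemma W_proj_self: "\<sigma> \<in> carrier (Gal F) \<Longrightarrow> \<sigma> \<in> W_proj \<sigma>"
  unfolding W_proj_def
  by (rule group.rcos_self[OF group_Gal _ normal_imp_subgroup[OF W_kernel_normal]])

lemma W_proj_mem:
  assumes "\<sigma> \<in> carrier (Gal F)" "\<tau> \<in> W_proj \<sigma>"
  shows "\<tau> \<in> carrier (Gal F)" "W_proj \<tau> = W_proj \<sigma>" "x \<in> W_field \<Longrightarrow> \<tau> x = \<sigma> x"
proof -
  obtain n where n: "n \<in> W_kernel F" "\<tau> = n \<circ> \<sigma>"
    using assms(2) unfolding W_proj_def r_coset_def by auto
  have n': "n \<in> carrier (Gal F)" "\<And>x. x \<in> W_field \<Longrightarrow> n x = x"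
    using n(1) unfolding W_kernel_eq by auto
  show "\<tau> \<in> carrier (Gal F)" unfolding n(2) by (rule Gal_comp[OF n'(1) assms(1)])
  show "W_proj \<tau> = W_proj \<sigma>"
    using group.repr_independence[OF group_Gal _ assms(1) normal_imp_subgroup[OF W_kernel_normal]] assms(2)
    unfolding W_proj_def by blast
  show "\<tau> x = \<sigma> x" if "x \<in> W_field"
    unfolding n(2) using n'(2)[OF W_field_stable[OF that assms(1)]] by simp
qed

text \<open>Elements of the W-group are thus restrictions of automorphisms to
  \<open>W_field\<close>, and its equations can be checked pointwise there.\<close>

lemma W_proj_eq_iff:
  assumes "\<sigma> \<in> carrier (Gal F)" "\<tau> \<in> carrier (Gal F)"
  shows "W_proj \<sigma> = W_proj \<tau> \<longleftrightarrow> (\<forall>x\<in>W_field. \<sigma> x = \<tau> x)"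
proof
  assume "W_proj \<sigma> = W_proj \<tau>"
  then show "\<forall>x\<in>W_field. \<sigma> x = \<tau> x"
    using W_proj_mem(3)[OF assms(2)] W_proj_self[OF assms(1)] by simp
next
  assume eq: "\<forall>x\<in>W_field. \<sigma> x = \<tau> x"
  let ?n = "\<sigma> \<circ> inv\<^bsub>Gal F\<^esub> \<tau>"
  have "?n x = x" if "x \<in> W_field" for x
    using eq W_field_stable[OF that Gal_inv(1)[OF assms(2)]] Gal_inv(3)[OF assms(2)] by simp
  then have "?n \<in> W_kernel F"
    unfolding W_kernel_eq using Gal_comp[OF assms(1) Gal_inv(1)[OF assms(2)]] by blast
  moreover have "\<sigma> = ?n \<circ> \<tau>" using Gal_inv(2)[OF assms(2)] by (simp add: fun_eq_iff)
  ultimately have "\<sigma> \<in> W_proj \<tau>" unfolding W_proj_def r_coset_def Gal_mult by blast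
  then show "W_proj \<sigma> = W_proj \<tau>" by (rule W_proj_mem(2)[OF assms(2)])
qed

section \<open>The image of \<open>sqrt_fixer\<close> and the Frattini subgroup\<close>

lemma sqrt_fixer_subset: "sqrt_fixer \<subseteq> carrier (Gal F)"
  unfolding sqrt_fixer_def by blast

text \<open>Since square roots lie in \<open>W_field\<close>, \<open>sqrt_fixer\<close> is a union
  of cosets of the kernel, and membership in its image can be tested on any representative.\<close>

lemma sqrt_fixer_cong:
  assumes "\<sigma> \<in> sqrt_fixer" "\<tau> \<in> carrier (Gal F)" "W_proj \<sigma> = W_proj \<tau>"
  shows "\<tau> \<in> sqrt_fixer"
proof -
  have \<sigma>: "\<sigma> \<in> carrier (Gal F)" using assms(1) sqrt_fixer_subset by blast
  have "\<tau> y = y" if "y * y \<in> F" for y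
    using assms(1,3) W_proj_eq_iff[OF \<sigma> assms(2)] sqrt_mem_W_field[OF that] that
    unfolding sqrt_fixer_def by auto
  then show ?thesis unfolding sqrt_fixer_def using assms(2) by blast
qed

lemma fixer_subgroup:
  "subgroup {\<sigma> \<in> carrier (Gal F). \<forall>y\<in>Y. \<sigma> y = y} (Gal F)"
proof (rule group.subgroupI[OF group_Gal])
  have "id \<in> {\<sigma> \<in> carrier (Gal F). \<forall>y\<in>Y. \<sigma> y = y}" using Gal_id by simp
  then show "{\<sigma> \<in> carrier (Gal F). \<forall>y\<in>Y. \<sigma> y = y} \<noteq> {}" by blast
  show "inv\<^bsub>Gal F\<^esub> \<sigma> \<in> {\<sigma> \<in> carrier (Gal F). \<forall>y\<in>Y. \<sigma> y = y}"
    if \<sigma>: "\<sigma> \<in> {\<sigma> \<in> carrier (Gal F). \<forall>y\<in>Y. \<sigma> y = y}" for \<sigma>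
  proof -
    have G: "\<sigma> \<in> carrier (Gal F)" using \<sigma> by blast
    have "(inv\<^bsub>Gal F\<^esub> \<sigma>) y = y" if "y \<in> Y" for y
      using Gal_inv(2)[OF G, of y] \<sigma> that by simp
    then show ?thesis using Gal_inv(1)[OF G] by blast
  qed
qed (auto intro!: Gal_comp)

lemma sqrt_fixer_eq: "sqrt_fixer = {\<sigma> \<in> carrier (Gal F). \<forall>y\<in>{y. y * y \<in> F}. \<sigma> y = y}"
  unfolding sqrt_fixer_def by auto

lemma W_proj_image_subgroup:
  "subgroup H (Gal F) \<Longrightarrow> subgroup (W_proj ` H) (W_group F)"
  by (rule group_hom.subgroup_img_is_subgroup[OF W_proj_hom])

lemma W_phi_central:
  assumes "a \<in> W_proj ` sqrt_fixer" "b \<in> carrier (W_group F)"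
  shows "a \<otimes>\<^bsub>W_group F\<^esub> b = b \<otimes>\<^bsub>W_group F\<^esub> a"
proof -
  obtain \<sigma> \<tau> where \<sigma>: "\<sigma> \<in> sqrt_fixer" "a = W_proj \<sigma>" and \<tau>: "\<tau> \<in> carrier (Gal F)" "b = W_proj \<tau>"
    using assms unfolding carrier_W by blast
  have \<sigma>G: "\<sigma> \<in> carrier (Gal F)" using \<sigma>(1) sqrt_fixer_subset by blast
  have "W_proj (\<sigma> \<circ> \<tau>) = W_proj (\<tau> \<circ> \<sigma>)"
    unfolding W_proj_eq_iff[OF Gal_comp[OF \<sigma>G \<tau>(1)] Gal_comp[OF \<tau>(1) \<sigma>G]]
    using sqrt_fixer_on_W_field(2)[OF \<sigma>(1) _ \<tau>(1)] by simp
  then show ?thesis using \<sigma> \<tau> W_proj_mult[OF \<sigma>G \<tau>(1)] W_proj_mult[OF \<tau>(1) \<sigma>G] by simp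
qed

lemma W_proj_square_eq_one_iff:
  assumes "\<sigma> \<in> carrier (Gal F)"
  shows "W_proj \<sigma> \<otimes>\<^bsub>W_group F\<^esub> W_proj \<sigma> = \<one>\<^bsub>W_group F\<^esub> \<longleftrightarrow> (\<forall>x\<in>W_field. \<sigma> (\<sigma> x) = x)"
  unfolding W_proj_mult[OF assms assms] W_proj_one[symmetric]
    W_proj_eq_iff[OF Gal_comp[OF assms assms] Gal_id] by simp

lemma W_phi_elem_abelian: "elem_abelian_2_subgroup (W_proj ` sqrt_fixer) (W_group F)"
  unfolding elem_abelian_2_subgroup_def
proof (intro conjI ballI)
  show sub: "subgroup (W_proj ` sqrt_fixer) (W_group F)"
    unfolding sqrt_fixer_eq by (rule W_proj_image_subgroup[OF fixer_subgroup])
  fix a assume a: "a \<in> W_proj ` sqrt_fixer"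
  then obtain \<sigma> where \<sigma>: "\<sigma> \<in> sqrt_fixer" "a = W_proj \<sigma>" by blast
  then show "a \<otimes>\<^bsub>W_group F\<^esub> a = \<one>\<^bsub>W_group F\<^esub>"
    using W_proj_square_eq_one_iff sqrt_fixer_subset sqrt_fixer_on_W_field(1) by blast
  fix b assume "b \<in> W_proj ` sqrt_fixer"
  then show "a \<otimes>\<^bsub>W_group F\<^esub> b = b \<otimes>\<^bsub>W_group F\<^esub> a"
    using W_phi_central[OF a] subgroup.mem_carrier[OF sub] by blast
qed

text \<open>If \<sigma> moves a square root y of an element of F, the stabiliser of y is open of
  index two and its image in the W-group is a maximal subgroup missing the class of
  \<sigma>.\<close>

lemma W_frattini_subset: "W_frattini F \<subseteq> W_proj ` sqrt_fixer"
proof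
  fix C assume C: "C \<in> W_frattini F"
  then obtain \<sigma> where \<sigma>: "\<sigma> \<in> carrier (Gal F)" "C = W_proj \<sigma>"
    unfolding W_frattini_def carrier_W by blast
  have "\<sigma> y = y" if y: "y * y \<in> F" for y
  proof (rule ccontr)
    assume ne: "\<sigma> y \<noteq> y"
    note yW = sqrt_mem_W_field[OF y]
    let ?H = "{\<tau> \<in> carrier (Gal F). \<forall>z\<in>{y}. \<tau> z = z}"
    let ?M = "W_proj ` ?H"
    \<comment> \<open>The image remembers whether y is fixed because y lies in
      \<open>W_field\<close>.\<close>
    have H: "\<tau> y = y" if "\<tau> \<in> carrier (Gal F)" "W_proj \<tau> \<in> ?M" for \<tau>
    proof -
      obtain \<rho> where \<rho>: "\<rho> \<in> ?H" "W_proj \<tau> = W_proj \<rho>" using \<open>W_proj \<tau> \<in> ?M\<close> by blast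
      then have "\<tau> y = \<rho> y" using W_proj_eq_iff[OF \<open>\<tau> \<in> carrier (Gal F)\<close>, of \<rho>] yW by blast
      then show ?thesis using \<rho>(1) by simp
    qed
    have "W_open F ?M"
      unfolding W_open_def krull_open_def
    proof (intro ballI exI[of _ "{y}"] conjI)
      fix \<tau> assume "\<tau> \<in> \<Union>?M"
      then obtain \<rho> where \<rho>: "\<rho> \<in> ?H" "\<tau> \<in> W_proj \<rho>" by blast
      then have "\<tau> y = y" using W_proj_mem(3)[of \<rho> \<tau> y] yW by simp
      show "{\<sigma> \<in> carrier (Gal F). \<forall>x\<in>{y}. \<sigma> x = \<tau> x} \<subseteq> \<Union>?M"
      proof
        fix \<theta> assume \<theta>: "\<theta> \<in> {\<sigma> \<in> carrier (Gal F). \<forall>x\<in>{y}. \<sigma> x = \<tau> x}"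
        then have "\<theta> \<in> ?H" using \<open>\<tau> y = y\<close> by simp
        then show "\<theta> \<in> \<Union>?M" using W_proj_self by blast
      qed
    qed simp
    moreover have "W_proj \<sigma> \<notin> ?M" using H[OF \<sigma>(1)] ne by blast
    then have "?M \<noteq> carrier (W_group F)" using \<sigma>(1) unfolding carrier_W by blast
    moreover have "M' = ?M \<or> M' = carrier (W_group F)"
      if M': "subgroup M' (W_group F)" "?M \<subseteq> M'" for M'
    proof (rule disjCI)
      assume "M' \<noteq> carrier (W_group F)"
      show "M' = ?M"
      proof (rule ccontr)
        assume "M' \<noteq> ?M"
        then obtain D where D: "D \<in> M'" "D \<notin> ?M" using M'(2) by blast
        then obtain \<rho> where \<rho>: "\<rho> \<in> carrier (Gal F)" "D = W_proj \<rho>"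
          using subgroup.mem_carrier[OF M'(1)] unfolding carrier_W by blast
        have "\<rho> y \<noteq> y" using D(2) \<rho> by auto
        then have \<rho>y: "\<rho> y = - y" using sqrt_image[OF y \<rho>(1)] by blast
        \<comment> \<open>Index two made explicit: if both \<theta> and \<rho> negate y, then
          \<theta> composed with the inverse of \<rho> fixes it.\<close>
        have "W_proj \<theta> \<in> M'" if \<theta>: "\<theta> \<in> carrier (Gal F)" for \<theta>
        proof (cases "\<theta> y = y")
          case True
          then show ?thesis using \<theta> M'(2) by blast
        next
          case False
          then have \<theta>y: "\<theta> y = - y" using sqrt_image[OF y \<theta>] by blast
          let ?r = "inv\<^bsub>Gal F\<^esub> \<rho>"
          have r: "?r \<in> carrier (Gal F)" by (rule Gal_inv(1)[OF \<rho>(1)])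
          have "?r (- y) = y" using Gal_inv(2)[OF \<rho>(1), of y] \<rho>y by simp
          then have "\<theta> (?r y) = y"
            using \<theta>y Gal_hom(5)[OF r, of y] Gal_hom(5)[OF \<theta>, of y] by (metis minus_minus)
          then have "W_proj (\<theta> \<circ> ?r) \<in> M'" using M'(2) Gal_comp[OF \<theta> r] by auto
          then have "W_proj (\<theta> \<circ> ?r) \<otimes>\<^bsub>W_group F\<^esub> W_proj \<rho> \<in> M'"
            using D(1) \<rho>(2) subgroup.m_closed[OF M'(1)] by blast
          moreover have "(\<theta> \<circ> ?r) \<circ> \<rho> = \<theta>" using Gal_inv(2)[OF \<rho>(1)] by (simp add: fun_eq_iff)
          ultimately show ?thesis using W_proj_mult[OF Gal_comp[OF \<theta> r] \<rho>(1)] by simp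
        qed
        then have "carrier (W_group F) \<subseteq> M'" unfolding carrier_W by blast
        then show False
          using \<open>M' \<noteq> carrier (W_group F)\<close> subgroup.subset[OF M'(1)] by blast
      qed
    qed
    moreover have "subgroup ?M (W_group F)" by (rule W_proj_image_subgroup[OF fixer_subgroup])
    ultimately have "C \<in> ?M" using C unfolding W_frattini_def by blast
    then show False using \<open>W_proj \<sigma> \<notin> ?M\<close> \<sigma>(2) by blast
  qed
  then show "C \<in> W_proj ` sqrt_fixer" using \<sigma> unfolding sqrt_fixer_def by blast
qed

text \<open>A maximal subgroup not containing the central subgroup would, together with it, generate the
  whole group and hence contain all squares; being open, it would contain their closure.\<close>
lemma W_frattini_superset: "W_proj ` sqrt_fixer \<subseteq> W_frattini F"
proof
  interpret W: group "W_group F" by (rule group_W)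
  fix C assume "C \<in> W_proj ` sqrt_fixer"
  then obtain \<sigma> where \<sigma>: "\<sigma> \<in> sqrt_fixer" "C = W_proj \<sigma>" by blast
  have \<sigma>G: "\<sigma> \<in> carrier (Gal F)" using \<sigma>(1) sqrt_fixer_subset by blast
  let ?P = "W_proj ` sqrt_fixer"
  have P: "subgroup ?P (W_group F)" "\<And>p. p \<in> ?P \<Longrightarrow> p \<otimes>\<^bsub>W_group F\<^esub> p = \<one>\<^bsub>W_group F\<^esub>"
    using W_phi_elem_abelian unfolding elem_abelian_2_subgroup_def by blast+
  have "C \<in> M"
    if M: "subgroup M (W_group F)" "W_open F M"
      "\<And>M'. subgroup M' (W_group F) \<Longrightarrow> M \<subseteq> M' \<Longrightarrow> M' = M \<or> M' = carrier (W_group F)" for M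
  proof (rule ccontr)
    assume CM: "C \<notin> M"
    note central = W.central_set_mult[OF P(1) W_phi_central M(1)]
    have all: "?P <#>\<^bsub>W_group F\<^esub> M = carrier (W_group F)"
      using M(3)[OF central(1,3)] central(2) \<sigma> CM by blast
    \<comment> \<open>Modulo the central group of exponent two, each \<open>w\<close> agrees with an
      element of \<open>M\<close>, so its square is the square of that element.\<close>
    have sq: "w \<otimes>\<^bsub>W_group F\<^esub> w \<in> M" if "w \<in> carrier (W_group F)" for w
    proof -
      obtain p m where pm: "p \<in> ?P" "m \<in> M" "w = p \<otimes>\<^bsub>W_group F\<^esub> m"
        using \<open>w \<in> carrier (W_group F)\<close> unfolding all[symmetric] set_mult_def by blast
      have "w \<otimes>\<^bsub>W_group F\<^esub> w = (p \<otimes>\<^bsub>W_group F\<^esub> p) \<otimes>\<^bsub>W_group F\<^esub> (m \<otimes>\<^bsub>W_group F\<^esub> m)"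
        unfolding pm(3) by (rule W.central_set_mult(4)[OF P(1) W_phi_central M(1) pm(1,2,1,2)])
      also have "\<dots> = m \<otimes>\<^bsub>W_group F\<^esub> m"
        using P(2)[OF pm(1)] subgroup.mem_carrier[OF M(1) pm(2)] by simp
      finally show ?thesis using subgroup.m_closed[OF M(1) pm(2) pm(2)] by simp
    qed
    have gsq: "W_proj s \<in> M" if s: "s \<in> squares" for s
    proof -
      obtain g where g: "g \<in> carrier (Gal F)" "s = g \<circ> g" using s unfolding squares_def by blast
      then have "W_proj g \<in> carrier (W_group F)" unfolding carrier_W by blast
      from sq[OF this] show ?thesis unfolding W_proj_mult[OF g(1) g(1)] g(2) .
    qed
    have gen: "W_proj s \<in> M" if "s \<in> generate (Gal F) squares" for s
      using that
    proof induction
      case one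
      show ?case unfolding Gal_one W_proj_one by (rule subgroup.one_closed[OF M(1)])
    next
      case (incl s)
      then show ?case by (rule gsq)
    next
      case (inv s)
      have "inv\<^bsub>W_group F\<^esub> (W_proj s) \<in> M"
        by (rule subgroup.m_inv_closed[OF M(1) gsq[OF inv]])
      moreover have "s \<in> carrier (Gal F)" using inv squares_subset by blast
      ultimately show ?case using group_hom.hom_inv[OF W_proj_hom] by simp
    next
      case (eng s t)
      have "s \<in> carrier (Gal F)" "t \<in> carrier (Gal F)"
        using eng.hyps group.generate_incl[OF group_Gal squares_subset] by blast+
      note mult = W_proj_mult[OF this]
      show ?case
        unfolding Gal_mult mult[symmetric] by (rule subgroup.m_closed[OF M(1) eng.IH])
    qed
    \<comment> \<open>Openness enters here: \<open>M\<close> contains a whole neighbourhood of the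
      identity, given by a finite set \<open>D\<close>. Correcting \<sigma> by a product of squares
      that agrees with it on \<open>D\<close> lands in that neighbourhood.\<close>
    have "id \<in> \<Union>M"
      using W_proj_self[OF Gal_id] subgroup.one_closed[OF M(1)] unfolding W_proj_one by blast
    then obtain D where D: "finite D" "{\<rho> \<in> carrier (Gal F). \<forall>x\<in>D. \<rho> x = id x} \<subseteq> \<Union>M"
      using M(2) unfolding W_open_def krull_open_def by blast
    obtain s where s: "s \<in> generate (Gal F) squares" "\<And>x. x \<in> D \<Longrightarrow> s x = \<sigma> x"
      using sqrt_fixer_approx[OF \<sigma>(1) D(1)] by blast
    have sG: "s \<in> carrier (Gal F)"
      using s(1) group.generate_incl[OF group_Gal squares_subset] by blast
    let ?\<rho> = "inv\<^bsub>Gal F\<^esub> s \<circ> \<sigma>"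
    have \<rho>G: "?\<rho> \<in> carrier (Gal F)" by (rule Gal_comp[OF Gal_inv(1)[OF sG] \<sigma>G])
    moreover have "?\<rho> x = id x" if "x \<in> D" for x
      using s(2)[OF that] Gal_inv(2)[OF sG, of x] by simp
    ultimately have "?\<rho> \<in> \<Union>M" using D(2) by blast
    then obtain B where B: "?\<rho> \<in> B" "B \<in> M" by blast
    then obtain \<tau> where \<tau>: "\<tau> \<in> carrier (Gal F)" "B = W_proj \<tau>"
      using subgroup.mem_carrier[OF M(1) B(2)] unfolding carrier_W by blast
    have "W_proj ?\<rho> = B" using W_proj_mem(2)[OF \<tau>(1)] B(1) \<tau>(2) by simp
    then have "W_proj s \<otimes>\<^bsub>W_group F\<^esub> W_proj ?\<rho> \<in> M"
      using subgroup.m_closed[OF M(1) gen[OF s(1)]] B(2) by simp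
    moreover have "s \<circ> ?\<rho> = \<sigma>" using Gal_inv(3)[OF sG] by (simp add: fun_eq_iff)
    ultimately have "C \<in> M" unfolding W_proj_mult[OF sG \<rho>G] \<sigma>(2) by (simp only:)
    then show False using CM by simp
  qed
  moreover have "C \<in> carrier (W_group F)" using \<sigma>(2) \<sigma>G unfolding carrier_W by blast
  ultimately show "C \<in> W_frattini F" unfolding W_frattini_def by blast
qed

lemma W_frattini_eq: "W_frattini F = W_proj ` sqrt_fixer"
  using W_frattini_subset W_frattini_superset by blast

section \<open>Involutions of the W-group\<close>

lemma involutions_mult_mem_phi:
  assumes s: "s \<in> carrier (W_group F)" "s \<otimes>\<^bsub>W_group F\<^esub> s = \<one>\<^bsub>W_group F\<^esub>" "s \<notin> W_proj ` sqrt_fixer"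
    and t: "t \<in> carrier (W_group F)" "t \<otimes>\<^bsub>W_group F\<^esub> t = \<one>\<^bsub>W_group F\<^esub>" "t \<notin> W_proj ` sqrt_fixer"
    and comm: "s \<otimes>\<^bsub>W_group F\<^esub> t = t \<otimes>\<^bsub>W_group F\<^esub> s"
  shows "s \<otimes>\<^bsub>W_group F\<^esub> t \<in> W_proj ` sqrt_fixer"
proof -
  interpret W: group "W_group F" by (rule group_W)
  obtain i where i: "i * i = (- 1 :: 'a)" using ex_sqrt by blast
  obtain \<sigma> \<tau> where \<sigma>: "\<sigma> \<in> carrier (Gal F)" "s = W_proj \<sigma>" and \<tau>: "\<tau> \<in> carrier (Gal F)" "t = W_proj \<tau>"
    using s(1) t(1) unfolding carrier_W by blast
  have st: "s \<otimes>\<^bsub>W_group F\<^esub> t = W_proj (\<sigma> \<circ> \<tau>)" using W_proj_mult[OF \<sigma>(1) \<tau>(1)] \<sigma>(2) \<tau>(2) by simp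
  have "\<sigma> i = - i"
    by (rule involution_moves_sqrt_minus_one[OF \<sigma>(1) _ _ i])
      (use s(2,3) \<sigma> W_proj_square_eq_one_iff[OF \<sigma>(1)] in blast)+
  moreover have "\<tau> i = - i"
    by (rule involution_moves_sqrt_minus_one[OF \<tau>(1) _ _ i])
      (use t(2,3) \<tau> W_proj_square_eq_one_iff[OF \<tau>(1)] in blast)+
  ultimately have "(\<sigma> \<circ> \<tau>) i = i" by (simp add: Gal_hom(5)[OF \<sigma>(1)])
  moreover have "i \<noteq> - i"
  proof
    assume "i = - i"
    then have "2 * i = 0" by (metis add.right_inverse mult_2)
    then have "i = 0" using two_neq_0 by simp
    then show False using i by simp
  qed
  ultimately have ne: "(\<sigma> \<circ> \<tau>) i \<noteq> - i" by simp
  \<comment> \<open>Commutativity is what makes the product an involution again.\<close>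
  have "(s \<otimes>\<^bsub>W_group F\<^esub> t) \<otimes>\<^bsub>W_group F\<^esub> (s \<otimes>\<^bsub>W_group F\<^esub> t) =
      (s \<otimes>\<^bsub>W_group F\<^esub> s) \<otimes>\<^bsub>W_group F\<^esub> (t \<otimes>\<^bsub>W_group F\<^esub> t)"
    using s(1) t(1) comm by (metis W.m_assoc W.m_closed)
  also have "\<dots> = \<one>\<^bsub>W_group F\<^esub>" unfolding s(2) t(2) by simp
  finally have "\<forall>x\<in>W_field. (\<sigma> \<circ> \<tau>) ((\<sigma> \<circ> \<tau>) x) = x"
    unfolding st W_proj_square_eq_one_iff[OF Gal_comp[OF \<sigma>(1) \<tau>(1)]] .
  \<comment> \<open>The contrapositive of \<open>involution_moves_sqrt_minus_one\<close>: an
    involution on \<open>W_field\<close> that does not negate \<open>i\<close> fixes all square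
    roots.\<close>
  then have "\<sigma> \<circ> \<tau> \<in> sqrt_fixer"
    using involution_moves_sqrt_minus_one[OF Gal_comp[OF \<sigma>(1) \<tau>(1)] _ _ i] ne by blast
  then show ?thesis unfolding st by blast
qed

lemma ex_W_involution:
  assumes "formally_real F"
  obtains c where "c \<in> carrier (W_group F)" "c \<otimes>\<^bsub>W_group F\<^esub> c = \<one>\<^bsub>W_group F\<^esub>" "c \<notin> W_proj ` sqrt_fixer"
proof -
  obtain c where c: "c \<in> carrier (Gal F)" "c \<circ> c = id" "\<And>i. i * i = - 1 \<Longrightarrow> c i = - i"
    using ex_involution[OF assms] by blast
  obtain i where i: "i * i = (- 1 :: 'a)" using ex_sqrt by blast
  have "c \<notin> sqrt_fixer"
  proof
    assume "c \<in> sqrt_fixer"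
    then have "c i = i" using i minus_one_mem unfolding sqrt_fixer_def by simp
    then have "2 * i = 0" using c(3)[OF i] by (metis add.right_inverse mult_2)
    then have "i = 0" using two_neq_0 by simp
    then show False using i by simp
  qed
  then have "W_proj c \<notin> W_proj ` sqrt_fixer" using sqrt_fixer_cong[OF _ c(1)] by auto
  moreover have "W_proj c \<otimes>\<^bsub>W_group F\<^esub> W_proj c = \<one>\<^bsub>W_group F\<^esub>"
    unfolding W_proj_mult[OF c(1) c(1)] c(2) by (rule W_proj_one)
  moreover have "W_proj c \<in> carrier (W_group F)" using c(1) unfolding carrier_W by blast
  ultimately show ?thesis using that by blast
qed

end

text \<open>In characteristic two, -1 equals 1 and is itself a square.\<close>

lemma formally_real_two_neq_0:
  fixes F :: "'a::field set"
  assumes "subfield_of F" "formally_real F"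
  shows "(2::'a) \<noteq> 0"
proof
  assume "(2::'a) = 0"
  then have "(1::'a) + 1 = 0" by simp
  then have "(1::'a) * 1 = - 1" by (simp add: eq_neg_iff_add_eq_0)
  moreover have "(1::'a) * 1 \<in> sums_of_squares F"
    by (rule sums_of_squares_square[OF subfield_of_closed(2)[OF assms(1)]])
  ultimately show False using assms(2) formally_real_iff by metis
qed

theorem theorem2p4:
  fixes F :: "'a::field set"
  assumes "subfield_of F"
    and "formally_real F"
    and "is_quadratic_closure F"
  shows "elem_abelian_2_subgroup (W_frattini F) (W_group F)
       \<and> (\<forall>a\<in>W_frattini F. \<forall>b\<in>carrier (W_group F).
             a \<otimes>\<^bsub>W_group F\<^esub> b = b \<otimes>\<^bsub>W_group F\<^esub> a)
       \<and> (\<forall>A. maximal_elem_abelian_subgroup A (W_group F) \<longrightarrow>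
             W_frattini F \<subseteq> A \<and>
             card (rcosets\<^bsub>(W_group F)\<lparr>carrier := A\<rparr>\<^esub> (W_frattini F)) = 2)"
proof -
  interpret quadratic_closure F
    using assms formally_real_two_neq_0 by unfold_locales
  interpret W: group "W_group F" by (rule group_W)
  obtain c where c: "c \<in> carrier (W_group F)" "c \<otimes>\<^bsub>W_group F\<^esub> c = \<one>\<^bsub>W_group F\<^esub>"
    "c \<notin> W_proj ` sqrt_fixer"
    using ex_W_involution[OF assms(2)] by blast
  note index_two = W.maximal_elem_abelian_index_two[OF W_phi_elem_abelian W_phi_central c
      involutions_mult_mem_phi]
  show ?thesis
    unfolding W_frattini_eq
    using W_phi_elem_abelian W_phi_central index_two by blast
qed

end
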